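(* Let $n\geq1$ be an integer and let $1\leq p<\infty$. The following are equivalent. (i) $\|\tau\colon F_n^p\to F_n^p\|_{cb}\leq1$ (equivalently, $\tau\colon F_n^p\to F_n^p$ is a complete isometry). (ii) $p$ is an even integer and $2n\geq p$.
   Context: For $N\ge1$, let $\Lambda_N=\bigoplus_{0\leq k\leq N}\Lambda_{N,k}$ be the anti-symmetric Fock space over the complex Hilbert space $\ell^2_N$ with canonical basis $(e_1,\dots,e_N)$: $\Lambda_{N,k}$ is the $k$-fold anti-symmetric tensor product with inner product $\langle \xi_1\wedge\cdots\wedge\xi_k,\xi_1'\wedge\cdots\wedge\xi_k'\rangle=\det[\langle\xi_i,\xi_j'\rangle]$, and $\Lambda_{N,0}=\mathbb{C}\Omega$ with $\Omega$ a unit vector. The creation operators are $c_{N,j}(\Omega)=e_j$, $c_{N,j}(\xi_1\wedge\cdots\wedge\xi_k)=e_j\wedge\xi_1\wedge\cdots\wedge\xi_k$, and the Fermions are $\omega_j=c_{N,j}+c_{N,j}^*$, $1\leq j\leq N$. $\mathcal{C}_N\subset B(\Lambda_N)$ is the $C^*$-algebra generated by $\omega_1,\dots,\omega_N$, with normalized trace $Tr(x)=\langle x(\Omega),\Omega\rangle$. For $1\leq p<\infty$, $L^p(\mathcal{C}_N)$ is $\mathcal{C}_N$ with norm $\|x\|_p=(Tr(|x|^p))^{1/p}$. $F_n=\mathrm{Span}\{1,\omega_1,\ldots,\omega_{2n},\omega_1\cdots\omega_{2n}\}\subset\mathcal{C}_{2n}$; $F_n^p$ is $F_n$ regarded as a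 subspace of $L^p(\mathcal{C}_{2n})$. $\tau\colon F_n\to F_n$ is the linear map with $\tau(1)=1$, $\tau(\omega_j)=\omega_j$ for $1\leq j\leq 2n$, and $\tau(\omega_1\cdots\omega_{2n})=-\omega_1\cdots\omega_{2n}$. For a linear map $u\colon X\to X$ with $X\subset L^p(\mathcal{C}_{2n})$, $\|u\|_{cb}=\sup_{k\geq1}\|I\otimes u\|$, where $I\otimes u$ acts as $[x_{ij}]\mapsto[u(x_{ij})]$ on the $k\times k$ matrices with entries in $X$, normed as a subspace of $L^p(M_k\otimes\mathcal{C}_{2n},\mathrm{tr}\otimes Tr)$ ($\mathrm{tr}$ the usual trace on $M_k$). $u$ is a complete isometry if all these maps $I\otimes u$ are isometric. *)

theory Defs
  imports
    "Jordan_Normal_Form.Determinant"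
    "Jordan_Normal_Form.Schur_Decomposition"
    "HOL-Library.Nat_Bijection"
    "HOL-Library.Extended_Real"
begin

section \<open>Anti-symmetric Fock space\<close>

text \<open>
  The canonical basis of the one-particle space is numbered from 0, so that it reads
  \<open>unit_vec N 0, \<dots>, unit_vec N (N - 1)\<close>.  The Fock space over it is modelled as \<open>carrier_vec (2 ^ N)\<close>
  with the inner product \<open>x \<bullet>c y\<close> (linear in \<open>x\<close>).  The coordinate with number \<open>A < 2 ^ N\<close> belongs to
  the set \<open>set_decode A \<subseteq> {..<N}\<close>, that is, to the basis vector \<open>e\<^bsub>a\<^sub>0\<^esub> \<and> e\<^bsub>a\<^sub>1\<^esub> \<and> \<dots>\<close> where
  \<open>a\<^sub>0 < a\<^sub>1 < \<dots>\<close> are the elements of that set; the coordinates of a wedge product are minors.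
  The lemmas \<open>wedge_inner\<close>, \<open>wedge_inner_degree\<close> (Gram determinant), \<open>wedge_unit_vecs\<close>
  (orthonormal basis) and \<open>creation_wedge\<close> show that this is the usual structure.
\<close>

definition basis_ix :: "nat \<Rightarrow> nat list" where
  "basis_ix A = sorted_list_of_set (set_decode A)"

definition minor :: "complex vec list \<Rightarrow> nat list \<Rightarrow> complex" where
  "minor xs as = det (mat (length xs) (length xs) (\<lambda>(i, r). xs ! i $ (as ! r)))"

definition wedge :: "nat \<Rightarrow> complex vec list \<Rightarrow> complex vec" where
  "wedge N xs = vec (2 ^ N)
     (\<lambda>A. if length (basis_ix A) = length xs then minor xs (basis_ix A) else 0)"

definition vacuum :: "nat \<Rightarrow> complex vec" where
  "vacuum N = wedge N []"

text \<open>The linear operator whose value on each basis vector \<open>e\<^bsub>a\<^sub>0\<^esub> \<and> e\<^bsub>a\<^sub>1\<^esub> \<and> \<dots>\<close> is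
  \<open>e\<^sub>j \<and> e\<^bsub>a\<^sub>0\<^esub> \<and> e\<^bsub>a\<^sub>1\<^esub> \<and> \<dots>\<close>; see \<open>creation_wedge\<close> for all other wedge products.\<close>

definition creation :: "nat \<Rightarrow> nat \<Rightarrow> complex mat" where
  "creation N j = mat_of_cols (2 ^ N)
     (map (\<lambda>A. wedge N (unit_vec N j # map (unit_vec N) (basis_ix A))) [0..<2 ^ N])"

definition fermion :: "nat \<Rightarrow> nat \<Rightarrow> complex mat" where
  "fermion N j = creation N j + mat_adjoint (creation N j)"

text \<open>The generated \<open>*\<close>-algebra; it is norm closed because it is finite-dimensional.\<close>

inductive_set fermion_algebra :: "nat \<Rightarrow> complex mat set" for N where
  one: "1\<^sub>m (2 ^ N) \<in> fermion_algebra N"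
| fermion: "j < N \<Longrightarrow> fermion N j \<in> fermion_algebra N"
| add: "x \<in> fermion_algebra N \<Longrightarrow> y \<in> fermion_algebra N \<Longrightarrow> x + y \<in> fermion_algebra N"
| smult: "x \<in> fermion_algebra N \<Longrightarrow> c \<cdot>\<^sub>m x \<in> fermion_algebra N"
| mult: "x \<in> fermion_algebra N \<Longrightarrow> y \<in> fermion_algebra N \<Longrightarrow> x * y \<in> fermion_algebra N"
| adjoint: "x \<in> fermion_algebra N \<Longrightarrow> mat_adjoint x \<in> fermion_algebra N"

definition Tr :: "nat \<Rightarrow> complex mat \<Rightarrow> complex" where
  "Tr N x = (x *\<^sub>v vacuum N) \<bullet>c vacuum N"


section \<open>Functional calculus and non-commutative \<open>L\<^sup>p\<close> norms\<close>

definition spectral_decomp :: "complex mat \<Rightarrow> complex mat \<Rightarrow> (nat \<Rightarrow> real) \<Rightarrow> bool" where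
  "spectral_decomp A U d \<longleftrightarrow>
     U \<in> carrier_mat (dim_row A) (dim_row A) \<and> mat_adjoint U * U = 1\<^sub>m (dim_row A) \<and>
     A = U * mat_diag (dim_row A) (\<lambda>i. complex_of_real (d i)) * mat_adjoint U"

text \<open>\<open>f(A)\<close> for Hermitian \<open>A\<close>: the matrix \<open>B\<close> exists and is unique by \<open>hermitian_spectral\<close> and
  \<open>hermitian_fun_eq\<close>.\<close>

definition hermitian_fun :: "(real \<Rightarrow> real) \<Rightarrow> complex mat \<Rightarrow> complex mat" where
  "hermitian_fun f A = (THE B. \<exists>U d. spectral_decomp A U d \<and>
     B = U * mat_diag (dim_row A) (\<lambda>i. complex_of_real (f (d i))) * mat_adjoint U)"

definition mat_abs :: "complex mat \<Rightarrow> complex mat" where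
  "mat_abs x = hermitian_fun sqrt (mat_adjoint x * x)"

text \<open>A \<open>k \<times> k\<close> matrix over operators on the Fock space is a function \<open>x\<close> of which only the
  entries \<open>x i j\<close> with \<open>i, j < k\<close> matter.  \<open>block_mat N k x\<close> is the operator
  \<open>\<Sum>\<^sub>i\<^sub>j E\<^sub>i\<^sub>j \<otimes> x i j\<close>, and \<open>block N Y i j\<close> extracts an entry again.\<close>

definition block_mat :: "nat \<Rightarrow> nat \<Rightarrow> (nat \<Rightarrow> nat \<Rightarrow> complex mat) \<Rightarrow> complex mat" where
  "block_mat N k x = mat (k * 2 ^ N) (k * 2 ^ N)
     (\<lambda>(r, s). x (r div 2 ^ N) (s div 2 ^ N) $$ (r mod 2 ^ N, s mod 2 ^ N))"

definition block :: "nat \<Rightarrow> complex mat \<Rightarrow> nat \<Rightarrow> nat \<Rightarrow> complex mat" where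
  "block N Y i j = mat (2 ^ N) (2 ^ N) (\<lambda>(r, s). Y $$ (i * 2 ^ N + r, j * 2 ^ N + s))"

definition tr_Tr :: "nat \<Rightarrow> nat \<Rightarrow> complex mat \<Rightarrow> complex" where
  "tr_Tr N k Y = (\<Sum>i<k. Tr N (block N Y i i))"

text \<open>The norm of \<open>L\<^sup>p(M\<^sub>k \<otimes> C\<^sub>N, tr \<otimes> Tr)\<close>; the trace inside is a nonnegative real number.\<close>

definition Lp_norm :: "real \<Rightarrow> nat \<Rightarrow> nat \<Rightarrow> (nat \<Rightarrow> nat \<Rightarrow> complex mat) \<Rightarrow> real" where
  "Lp_norm p N k x =
     (Re (tr_Tr N k (hermitian_fun (\<lambda>t. t powr p) (mat_abs (block_mat N k x))))) powr (1 / p)"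


section \<open>Completely bounded norm\<close>

definition mats_over :: "nat \<Rightarrow> complex mat set \<Rightarrow> (nat \<Rightarrow> nat \<Rightarrow> complex mat) set" where
  "mats_over k X = {x. \<forall>i<k. \<forall>j<k. x i j \<in> X}"

definition amplify :: "(complex mat \<Rightarrow> complex mat) \<Rightarrow>
    (nat \<Rightarrow> nat \<Rightarrow> complex mat) \<Rightarrow> nat \<Rightarrow> nat \<Rightarrow> complex mat" where
  "amplify u x = (\<lambda>i j. u (x i j))"

definition amp_norm :: "real \<Rightarrow> nat \<Rightarrow> complex mat set \<Rightarrow> (complex mat \<Rightarrow> complex mat) \<Rightarrow>
    nat \<Rightarrow> ereal" where
  "amp_norm p N X u k =
     (SUP x \<in> {x \<in> mats_over k X. Lp_norm p N k x \<le> 1}. ereal (Lp_norm p N k (amplify u x)))"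

definition cb_norm :: "real \<Rightarrow> nat \<Rightarrow> complex mat set \<Rightarrow> (complex mat \<Rightarrow> complex mat) \<Rightarrow> ereal" where
  "cb_norm p N X u = (SUP k \<in> {1..}. amp_norm p N X u k)"

definition complete_isometry ::
    "real \<Rightarrow> nat \<Rightarrow> complex mat set \<Rightarrow> (complex mat \<Rightarrow> complex mat) \<Rightarrow> bool" where
  "complete_isometry p N X u \<longleftrightarrow>
     (\<forall>k\<ge>1. \<forall>x \<in> mats_over k X. Lp_norm p N k (amplify u x) = Lp_norm p N k x)"


section \<open>The space \<open>F\<^sub>n\<close> and the map \<open>\<tau>\<close>\<close>

definition fermion_prod :: "nat \<Rightarrow> complex mat" where
  "fermion_prod n = foldr (*) (map (fermion (2 * n)) [0..<2 * n]) (1\<^sub>m (2 ^ (2 * n)))"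

text \<open>\<open>a 1 + \<Sum>\<^sub>j b\<^sub>j \<omega>\<^sub>j + c \<omega>\<^sub>1\<cdots>\<omega>\<^sub>2\<^sub>n\<close>\<close>

definition F_comb :: "nat \<Rightarrow> complex \<Rightarrow> (nat \<Rightarrow> complex) \<Rightarrow> complex \<Rightarrow> complex mat" where
  "F_comb n a b c = a \<cdot>\<^sub>m 1\<^sub>m (2 ^ (2 * n))
     + foldr (+) (map (\<lambda>j. b j \<cdot>\<^sub>m fermion (2 * n) j) [0..<2 * n]) (0\<^sub>m (2 ^ (2 * n)) (2 ^ (2 * n)))
     + c \<cdot>\<^sub>m fermion_prod n"

definition F_space :: "nat \<Rightarrow> complex mat set" where
  "F_space n = {F_comb n a b c | a b c. True}"

text \<open>For \<open>n \<ge> 1\<close> the generators of \<open>F_space n\<close> are linearly independent, so this is well defined on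
  \<open>F_space n\<close>, linear, and has the prescribed values; see the \<open>tau\<close> lemmas at the end.\<close>

definition tau :: "nat \<Rightarrow> complex mat \<Rightarrow> complex mat" where
  "tau n x = (THE y. \<exists>a b c. x = F_comb n a b c \<and> y = F_comb n a b (- c))"


section \<open>Properties\<close>

subsection \<open>Index sets\<close>

lemma set_basis_ix [simp]: "set (basis_ix A) = set_decode A"
  by (simp add: basis_ix_def)

lemma distinct_basis_ix [simp]: "distinct (basis_ix A)"
  by (simp add: basis_ix_def)

lemma sorted_basis_ix [simp]: "sorted_wrt (<) (basis_ix A)"
  by (simp add: basis_ix_def)

lemma basis_ix_0 [simp]: "basis_ix 0 = []"
  by (simp add: basis_ix_def)

lemma set_decode_less: "A < 2 ^ N \<Longrightarrow> i \<in> set_decode A \<Longrightarrow> i < N"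
proof (rule ccontr)
  assume A: "A < 2 ^ N" and i: "i \<in> set_decode A" and "\<not> i < N"
  then have "(2::nat) ^ N \<le> 2 ^ i" by simp
  with A have "A < 2 ^ i" by linarith
  then show False using i by (simp add: set_decode_def)
qed

lemma set_encode_less: "S \<subseteq> {..<N} \<Longrightarrow> set_encode S < 2 ^ N"
proof -
  assume S: "S \<subseteq> {..<N}"
  have "set_encode S \<le> (\<Sum>i<N. 2 ^ i)"
    unfolding set_encode_def by (rule sum_mono2) (use S in auto)
  also have "\<dots> < 2 ^ N" by (induction N) auto
  finally show ?thesis .
qed

lemma power_less_iff_decode: "set_decode A \<subseteq> {..<N} \<longleftrightarrow> A < 2 ^ N"
  using set_encode_less[of "set_decode A" N] set_decode_less[of A N] by auto

lemma power_le_of_mem: "j \<in> set_decode A \<Longrightarrow> 2 ^ j \<le> A"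
  unfolding set_decode_def by (metis (no_types, lifting) div_less even_zero mem_Collect_eq not_less)

lemma set_decode_add: "j \<notin> set_decode A \<Longrightarrow> set_decode (A + 2 ^ j) = insert j (set_decode A)"
  by (metis add.commute set_decode_plus_power_2)

lemma set_decode_diff:
  assumes "j \<in> set_decode A"
  shows "set_decode (A - 2 ^ j) = set_decode A - {j}"
proof -
  have "A = set_encode (insert j (set_decode A - {j}))"
    using assms by (simp add: insert_absorb)
  also have "\<dots> = 2 ^ j + set_encode (set_decode A - {j})"
    by (subst set_encode_insert) auto
  finally have "A - 2 ^ j = set_encode (set_decode A - {j})" by simp
  then show ?thesis by simp
qed

lemma set_decode_inj: "set_decode A = set_decode B \<Longrightarrow> A = B"
  by (metis set_decode_inverse)

lemma add_power_less: "A < 2 ^ N \<Longrightarrow> j < N \<Longrightarrow> j \<notin> set_decode A \<Longrightarrow> A + 2 ^ j < 2 ^ N"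
  using set_decode_less[of A N]
  by (auto simp: power_less_iff_decode[symmetric] set_decode_add)

definition del :: "nat \<Rightarrow> 'a list \<Rightarrow> 'a list" where
  "del r xs = take r xs @ drop (Suc r) xs"

lemma length_del [simp]: "r < length xs \<Longrightarrow> length (del r xs) = length xs - 1"
  by (simp add: del_def)

lemma nth_del:
  "r < length xs \<Longrightarrow> i < length xs - 1 \<Longrightarrow> del r xs ! i = xs ! (if i < r then i else Suc i)"
  by (auto simp: del_def nth_append min_def)

lemma del_0_Cons [simp]: "del 0 (x # xs) = xs"
  by (simp add: del_def)

lemma basis_ix_del:
  assumes "p < length (basis_ix B)"
  shows "del p (basis_ix B) = basis_ix (B - 2 ^ (basis_ix B ! p))"
proof -
  let ?b = "basis_ix B"
  have split: "?b = take p ?b @ ?b ! p # drop (Suc p) ?b"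
    using assms by (rule id_take_nth_drop)
  have so: "sorted_wrt (<) (take p ?b @ ?b ! p # drop (Suc p) ?b)"
    using sorted_basis_ix[of B] split by simp
  have so': "sorted_wrt (<) (del p ?b)"
    using so unfolding del_def by (auto simp: sorted_wrt_append)
  have mem: "?b ! p \<in> set_decode B"
    using assms nth_mem set_basis_ix by metis
  have "set (take p ?b @ ?b ! p # drop (Suc p) ?b) = set_decode B"
    using split by (metis set_basis_ix)
  moreover have "?b ! p \<notin> set (take p ?b) \<union> set (drop (Suc p) ?b)"
    using so by (fastforce simp: sorted_wrt_append)
  ultimately have "set (del p ?b) = set_decode B - {?b ! p}"
    unfolding del_def by auto
  then have "set (del p ?b) = set_decode (B - 2 ^ (?b ! p))"
    by (simp add: set_decode_diff[OF mem])
  then show ?thesis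
    using so' by (metis basis_ix_def sorted_list_of_set_unique finite_set_decode
        strict_sorted_iff sorted_list_of_set.idem_if_sorted_distinct)
qed

definition pos :: "nat \<Rightarrow> nat \<Rightarrow> nat" where
  "pos j A = card {i \<in> set_decode A. i < j}"

lemma pos_nth:
  assumes "p < length (basis_ix B)"
  shows "pos (basis_ix B ! p) B = p"
proof -
  let ?b = "basis_ix B"
  have split: "?b = take p ?b @ ?b ! p # drop (Suc p) ?b"
    using assms by (rule id_take_nth_drop)
  have so: "sorted_wrt (<) (take p ?b @ ?b ! p # drop (Suc p) ?b)"
    using sorted_basis_ix[of B] split by simp
  have "set_decode B = set (take p ?b) \<union> insert (?b ! p) (set (drop (Suc p) ?b))"
    using split by (metis list.simps(15) set_append set_basis_ix)
  then have "{i \<in> set_decode B. i < ?b ! p}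
      = {i \<in> set (take p ?b) \<union> insert (?b ! p) (set (drop (Suc p) ?b)). i < ?b ! p}"
    by simp
  also have "\<dots> = set (take p ?b)"
    using so by (auto simp: sorted_wrt_append)
  finally have "{i \<in> set_decode B. i < ?b ! p} = set (take p ?b)" .
  then have ?thesis if "distinct (take p ?b)"
    using that unfolding pos_def using assms by (simp add: distinct_card)
  then show ?thesis by simp
qed

subsection \<open>Minors\<close>

lemma minor_Nil [simp]: "minor [] as = 1"
  by (simp add: minor_def)

lemma minor_mat_delete:
  assumes "length xs = Suc k" "length as = Suc k" "s < Suc k" "p < Suc k"
  shows "det (mat_delete (mat (Suc k) (Suc k) (\<lambda>(i, r). xs ! i $ (as ! r))) s p)
       = minor (del s xs) (del p as)"
  unfolding minor_def mat_delete_def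
  by (rule arg_cong[of _ _ det], rule eq_matI) (use assms in \<open>auto simp: nth_del\<close>)

lemma minor_laplace_row:
  assumes "length as = Suc (length xs)"
  shows "minor (x # xs) as = (\<Sum>r<Suc (length xs). (- 1) ^ r * x $ (as ! r) * minor xs (del r as))"
proof -
  let ?k = "length xs"
  let ?M = "mat (Suc ?k) (Suc ?k) (\<lambda>(i, r). (x # xs) ! i $ (as ! r))"
  have "minor (x # xs) as = det ?M" by (simp add: minor_def)
  also have "\<dots> = (\<Sum>r<Suc ?k. ?M $$ (0, r) * cofactor ?M 0 r)"
    by (rule laplace_expansion_row) auto
  also have "\<dots> = (\<Sum>r<Suc ?k. (- 1) ^ r * x $ (as ! r) * minor xs (del r as))"
  proof (rule sum.cong[OF refl])
    fix r assume "r \<in> {..<Suc ?k}"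
    then show "?M $$ (0, r) * cofactor ?M 0 r = (- 1) ^ r * x $ (as ! r) * minor xs (del r as)"
      using minor_mat_delete[of "x # xs" ?k as 0 r] assms by (simp add: cofactor_def)
  qed
  finally show ?thesis .
qed

lemma minor_laplace_col:
  assumes "length xs = Suc k" "length as = Suc k" "p < Suc k"
  shows "minor xs as
       = (\<Sum>s<Suc k. (- 1) ^ (s + p) * (xs ! s $ (as ! p)) * minor (del s xs) (del p as))"
proof -
  let ?M = "mat (Suc k) (Suc k) (\<lambda>(i, r). xs ! i $ (as ! r))"
  have "minor xs as = det ?M" using assms by (simp add: minor_def)
  also have "\<dots> = (\<Sum>s<Suc k. ?M $$ (s, p) * cofactor ?M s p)"
    by (rule laplace_expansion_column) (use assms in auto)
  also have "\<dots> = (\<Sum>s<Suc k. (- 1) ^ (s + p) * (xs ! s $ (as ! p)) * minor (del s xs) (del p as))"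
    by (rule sum.cong[OF refl])
      (use assms minor_mat_delete[OF assms(1,2) _ assms(3)] in \<open>auto simp: cofactor_def\<close>)
  finally show ?thesis .
qed

lemma minor_repeated:
  assumes "length as = length xs" "\<not> distinct as"
  shows "minor xs as = 0"
proof -
  obtain i j where ij: "i < length xs" "j < length xs" "i \<noteq> j" "as ! i = as ! j"
    using assms by (metis distinct_conv_nth)
  show ?thesis unfolding minor_def
    by (rule det_identical_columns[where n = "length xs" and i = i and j = j]) (use ij in auto)
qed

subsection \<open>Wedge products\<close>

lemma dim_wedge [simp]: "dim_vec (wedge N xs) = 2 ^ N"
  by (simp add: wedge_def)

lemma wedge_carrier [simp]: "wedge N xs \<in> carrier_vec (2 ^ N)"
  by (simp add: carrier_vecI)

lemma wedge_index:
  "A < 2 ^ N \<Longrightarrow> wedge N xs $ A = (if length (basis_ix A) = length xs then minor xs (basis_ix A) else 0)"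
  by (simp add: wedge_def)

lemma diff_less_pow: "A < 2 ^ N \<Longrightarrow> A - 2 ^ j < (2 ^ N :: nat)"
  by simp

lemma wedge_Cons_index:
  assumes B: "B < 2 ^ N"
  shows "wedge N (x # xs) $ B
       = (\<Sum>j\<in>set_decode B. (- 1) ^ pos j B * x $ j * wedge N xs $ (B - 2 ^ j))"
proof -
  let ?b = "basis_ix B"
  have bij: "bij_betw (\<lambda>r. ?b ! r) {..<length ?b} (set_decode B)"
    using bij_betw_nth[of ?b "{..<length ?b}" "set_decode B"] by simp
  have len: "length (basis_ix (B - 2 ^ (?b ! r))) = length ?b - 1" if "r < length ?b" for r
    using basis_ix_del[OF that] length_del[OF that] by metis
  have "(\<Sum>j\<in>set_decode B. (- 1) ^ pos j B * x $ j * wedge N xs $ (B - 2 ^ j))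
      = (\<Sum>r<length ?b. (- 1) ^ pos (?b ! r) B * x $ (?b ! r) * wedge N xs $ (B - 2 ^ (?b ! r)))"
    by (rule sum.reindex_bij_betw[OF bij, symmetric])
  also have "\<dots> = (\<Sum>r<length ?b. (- 1) ^ r * x $ (?b ! r) *
      (if length ?b - 1 = length xs then minor xs (del r ?b) else 0))"
    by (rule sum.cong[OF refl])
      (use B in \<open>auto simp: pos_nth wedge_index diff_less_pow len basis_ix_del\<close>)
  also have "\<dots> = wedge N (x # xs) $ B"
  proof (cases "length ?b = Suc (length xs)")
    case True
    then show ?thesis
      by (simp add: wedge_index[OF B] minor_laplace_row[OF True])
  next
    case False
    then show ?thesis
      by (cases ?b) (auto simp: wedge_index[OF B] intro!: sum.neutral)
  qed
  finally show ?thesis by simp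
qed

lemma unit_vec_index: "b < n \<Longrightarrow> unit_vec n a $ b = (if b = a then 1 else 0)"
  by (simp add: unit_vec_def)

lemma wedge_Cons_unit_index:
  assumes B: "B < 2 ^ N"
  shows "wedge N (unit_vec N j # xs) $ B
       = (if j \<in> set_decode B then (- 1) ^ pos j B * wedge N xs $ (B - 2 ^ j) else 0)"
proof -
  have "wedge N (unit_vec N j # xs) $ B
      = (\<Sum>i\<in>set_decode B. if i = j then (- 1) ^ pos j B * wedge N xs $ (B - 2 ^ j) else 0)"
    unfolding wedge_Cons_index[OF B]
    by (rule sum.cong[OF refl]) (use set_decode_less[OF B] in \<open>auto simp: unit_vec_index\<close>)
  then show ?thesis by simp
qed

theorem wedge_unit_vecs:
  assumes A: "A < 2 ^ N"
  shows "wedge N (map (unit_vec N) (basis_ix A)) = unit_vec (2 ^ N) A"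
proof (rule eq_vecI)
  fix B assume "B < dim_vec (unit_vec (2 ^ N) A :: complex vec)"
  then have B: "B < 2 ^ N" by simp
  let ?k = "length (basis_ix A)"
  let ?M = "mat ?k ?k (\<lambda>(i, r). map (unit_vec N) (basis_ix A) ! i $ (basis_ix B ! r)) :: complex mat"
  have inB: "basis_ix B ! r < N" if "r < length (basis_ix B)" for r
    using that set_decode_less[OF B] by (metis nth_mem set_basis_ix)
  show "wedge N (map (unit_vec N) (basis_ix A)) $ B = unit_vec (2 ^ N) A $ B"
  proof (cases "A = B")
    case True
    have "?M = 1\<^sub>m ?k"
      by (rule eq_matI) (use True inB in \<open>auto simp: nth_eq_iff_index_eq\<close>)
    then show ?thesis using True A by (simp add: wedge_index minor_def)
  next
    case False
    show ?thesis
    proof (cases "length (basis_ix B) = ?k")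
      case True
      have "card (set_decode A) = card (set_decode B)"
        using True by (metis distinct_basis_ix distinct_card set_basis_ix)
      then have "\<not> set_decode A \<subseteq> set_decode B"
        using False by (metis card_subset_eq finite_set_decode set_decode_inj)
      then obtain i where i: "i < ?k" "basis_ix A ! i \<notin> set_decode B"
        by (metis in_set_conv_nth set_basis_ix subsetI)
      have "?M $$ (i, r) = 0" if "r < ?k" for r
      proof -
        have "basis_ix B ! r \<in> set_decode B"
          using that True by (metis nth_mem set_basis_ix)
        then have "basis_ix B ! r \<noteq> basis_ix A ! i" using i by metis
        then show ?thesis using that i inB[of r] True by (simp add: unit_vec_index)
      qed
      moreover have "det ?M = (\<Sum>r<?k. ?M $$ (i, r) * cofactor ?M i r)"
        by (rule laplace_expansion_row) (use i in auto)
      ultimately have "det ?M = 0" by simp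
      then show ?thesis using False A B True by (simp add: wedge_index minor_def)
    next
      case len: False
      then show ?thesis using \<open>A \<noteq> B\<close> A B by (simp add: wedge_index)
    qed
  qed
qed simp

lemma vacuum_unit: "vacuum N = unit_vec (2 ^ N) 0"
  using wedge_unit_vecs[of 0 N] by (simp add: vacuum_def)

lemma creation_carrier [simp]: "creation N j \<in> carrier_mat (2 ^ N) (2 ^ N)"
  unfolding creation_def using mat_of_cols_carrier(1)[of "2 ^ N"] by (metis length_map length_upt minus_nat.diff_0)

lemma creation_dim [simp]: "dim_row (creation N j) = 2 ^ N" "dim_col (creation N j) = 2 ^ N"
  using creation_carrier[of N j] by blast+

lemma creation_index:
  assumes "B < 2 ^ N" "A < 2 ^ N"
  shows "creation N j $$ (B, A)
       = (if j \<in> set_decode B \<and> A = B - 2 ^ j then (- 1) ^ pos j B else 0)"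
proof -
  have "creation N j $$ (B, A) = wedge N (unit_vec N j # map (unit_vec N) (basis_ix A)) $ B"
    unfolding creation_def using assms by (subst mat_of_cols_index) auto
  then show ?thesis
    using assms by (simp add: wedge_Cons_unit_index wedge_unit_vecs)
qed

theorem creation_wedge: "creation N j *\<^sub>v wedge N xs = wedge N (unit_vec N j # xs)"
proof (rule eq_vecI)
  fix B assume "B < dim_vec (wedge N (unit_vec N j # xs))"
  then have B: "B < 2 ^ N" by simp
  have "(creation N j *\<^sub>v wedge N xs) $ B = (\<Sum>A<2 ^ N. creation N j $$ (B, A) * wedge N xs $ A)"
    using B by (simp add: scalar_prod_def lessThan_atLeast0)
  also have "\<dots> = (\<Sum>A<2 ^ N. if A = B - 2 ^ j then
       (if j \<in> set_decode B then (- 1) ^ pos j B * wedge N xs $ (B - 2 ^ j) else 0) else 0)"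
    by (rule sum.cong[OF refl]) (use B in \<open>auto simp: creation_index\<close>)
  also have "\<dots> = wedge N (unit_vec N j # xs) $ B"
    using B by (simp add: wedge_Cons_unit_index diff_less_pow)
  finally show "(creation N j *\<^sub>v wedge N xs) $ B = wedge N (unit_vec N j # xs) $ B" .
qed (use creation_carrier[of N j] in auto)

theorem wedge_inner_degree:
  assumes "length xs \<noteq> length ys"
  shows "wedge N xs \<bullet>c wedge N ys = 0"
  unfolding scalar_prod_def using assms by (auto intro!: sum.neutral simp: wedge_index)

lemma inner_sum: "y \<in> carrier_vec m \<Longrightarrow> x \<bullet>c y = (\<Sum>i<m. x $ i * cnj (y $ i))"
  by (auto simp: scalar_prod_def lessThan_atLeast0)

lemma wedge_annihilate:
  assumes A: "A < 2 ^ N" and j: "j < N" and ys: "length ys = Suc k"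
  shows "(\<Sum>s<Suc k. (- 1) ^ s * (ys ! s $ j) * wedge N (del s ys) $ A)
       = (if j \<in> set_decode A then 0 else (- 1) ^ pos j (A + 2 ^ j) * wedge N ys $ (A + 2 ^ j))"
proof (cases "length (basis_ix A) = k")
  case False
  have "length (basis_ix (A + 2 ^ j)) \<noteq> Suc k" if "j \<notin> set_decode A"
  proof -
    have "length (basis_ix (A + 2 ^ j)) = card (set_decode (A + 2 ^ j))"
      by (simp add: basis_ix_def)
    also have "\<dots> = Suc (length (basis_ix A))"
      using that by (simp add: set_decode_add basis_ix_def)
    finally show ?thesis using False by simp
  qed
  then show ?thesis using False ys A j
    by (auto intro!: sum.neutral simp: wedge_index add_power_less)
next
  case len: True
  show ?thesis
  proof (cases "j \<in> set_decode A")
    case True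
    have "0 = minor ys (j # basis_ix A)"
      by (rule minor_repeated[symmetric]) (use True len ys in auto)
    also have "\<dots> = (\<Sum>s<Suc k. (- 1) ^ s * (ys ! s $ j) * minor (del s ys) (basis_ix A))"
      using minor_laplace_col[of ys k "j # basis_ix A" 0] ys len by simp
    finally show ?thesis using True A len ys by (simp add: wedge_index)
  next
    case False
    let ?B = "A + 2 ^ j"
    have B: "?B < 2 ^ N" using A j False by (rule add_power_less)
    have "j \<in> set (basis_ix ?B)" using False by (simp add: set_decode_add)
    then obtain p where p: "p < length (basis_ix ?B)" "basis_ix ?B ! p = j"
      by (metis in_set_conv_nth)
    have dl: "del p (basis_ix ?B) = basis_ix A" using basis_ix_del[OF p(1)] p(2) by simp
    have lB: "length (basis_ix ?B) = Suc k"
      using length_del[OF p(1)] dl len p(1) by simp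
    have pp: "pos j ?B = p" using pos_nth[OF p(1)] p(2) by simp
    have "wedge N ys $ ?B = (\<Sum>s<Suc k. (- 1) ^ (s + p) * (ys ! s $ j) * minor (del s ys) (basis_ix A))"
      using minor_laplace_col[of ys k "basis_ix ?B" p] ys lB p dl by (simp add: wedge_index[OF B])
    also have "\<dots> = (- 1) ^ p * (\<Sum>s<Suc k. (- 1) ^ s * (ys ! s $ j) * wedge N (del s ys) $ A)"
      unfolding sum_distrib_left
      by (rule sum.cong[OF refl]) (use A len ys in \<open>auto simp: wedge_index power_add\<close>)
    finally have "(- 1) ^ p * (wedge N ys $ ?B)
       = ((- 1) ^ p * (- 1) ^ p) * (\<Sum>s<Suc k. (- 1) ^ s * (ys ! s $ j) * wedge N (del s ys) $ A)"
      by (simp only: mult.assoc)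
    moreover have "(- 1 :: complex) ^ p * (- 1) ^ p = 1"
      by (simp flip: power_add)
    ultimately show ?thesis using False pp by simp
  qed
qed

theorem wedge_inner:
  assumes "length xs = length ys" "set xs \<subseteq> carrier_vec N" "set ys \<subseteq> carrier_vec N"
  shows "wedge N xs \<bullet>c wedge N ys
       = det (mat (length xs) (length xs) (\<lambda>(i, j). xs ! i \<bullet>c ys ! j))"
  using assms
proof (induction xs arbitrary: ys)
  case Nil
  have "(\<Sum>i\<in>{0..<2 ^ N :: nat}. if i = 0 then 1 else 0 :: complex) = 1" by simp
  then show ?case using Nil vacuum_unit[of N] by (simp add: vacuum_def)
next
  case (Cons x xs)
  let ?k = "length xs"
  define w where "w = (\<lambda>A. wedge N xs $ A)"
  define K where "K = (\<lambda>j A. \<Sum>s<Suc ?k. (- 1) ^ s * (ys ! s $ j) * wedge N (del s ys) $ A)"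
  let ?M = "mat (Suc ?k) (Suc ?k) (\<lambda>(i, j). (x # xs) ! i \<bullet>c ys ! j)"
  have ly: "length ys = Suc ?k" using Cons.prems by simp
  have ysc: "ys ! s \<in> carrier_vec N" if "s < Suc ?k" for s
    using that Cons.prems(3) ly by (metis nth_mem subsetD)
  have sub: "det (mat_delete ?M 0 s) = wedge N xs \<bullet>c wedge N (del s ys)" if s: "s < Suc ?k" for s
  proof -
    have dc: "set (del s ys) \<subseteq> carrier_vec N"
      using Cons.prems(3) set_take_subset[of s ys] set_drop_subset[of "Suc s" ys]
      unfolding del_def by auto
    have "wedge N xs \<bullet>c wedge N (del s ys) = det (mat ?k ?k (\<lambda>(i, j). xs ! i \<bullet>c del s ys ! j))"
      by (rule Cons.IH) (use s ly dc Cons.prems in auto)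
    also have "mat ?k ?k (\<lambda>(i, j). xs ! i \<bullet>c del s ys ! j) = mat_delete ?M 0 s"
      unfolding mat_delete_def
      by (rule eq_matI) (use s ly in \<open>auto simp: nth_del\<close>)
    finally show ?thesis by simp
  qed
  have "det ?M = (\<Sum>s<Suc ?k. ?M $$ (0, s) * cofactor ?M 0 s)"
    by (rule laplace_expansion_row) auto
  also have "\<dots> = (\<Sum>s<Suc ?k. (- 1) ^ s * (x \<bullet>c ys ! s) * (wedge N xs \<bullet>c wedge N (del s ys)))"
    by (rule sum.cong[OF refl]) (auto simp: cofactor_def sub)
  also have "\<dots> = (\<Sum>s<Suc ?k. (\<Sum>j<N. \<Sum>A<2 ^ N.
      x $ j * w A * cnj ((- 1) ^ s * (ys ! s $ j) * wedge N (del s ys) $ A)))"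
    by (rule sum.cong[OF refl],
        simp add: ysc inner_sum[of _ N] inner_sum[of _ "2 ^ N"] sum_product sum_distrib_left w_def
          algebra_simps, rule sum.swap)
  also have "\<dots> = (\<Sum>j<N. \<Sum>s<Suc ?k. \<Sum>A<2 ^ N.
      x $ j * w A * cnj ((- 1) ^ s * (ys ! s $ j) * wedge N (del s ys) $ A))"
    by (rule sum.swap)
  also have "\<dots> = (\<Sum>j<N. \<Sum>A<2 ^ N. \<Sum>s<Suc ?k.
      x $ j * w A * cnj ((- 1) ^ s * (ys ! s $ j) * wedge N (del s ys) $ A))"
    by (intro sum.cong[OF refl] sum.swap)
  also have "\<dots> = (\<Sum>j<N. \<Sum>A<2 ^ N. x $ j * w A * cnj (K j A))"
    unfolding K_def cnj_sum sum_distrib_left ..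
  also have "\<dots> = (\<Sum>j<N. \<Sum>A | A < 2 ^ N \<and> j \<notin> set_decode A.
       x $ j * w A * ((- 1) ^ pos j (A + 2 ^ j) * cnj (wedge N ys $ (A + 2 ^ j))))"
  proof (rule sum.cong[OF refl])
    fix j assume j: "j \<in> {..<N}"
    have "(\<Sum>A<2 ^ N. x $ j * w A * cnj (K j A)) =
      (\<Sum>A<2 ^ N. if j \<notin> set_decode A then
         x $ j * w A * ((- 1) ^ pos j (A + 2 ^ j) * cnj (wedge N ys $ (A + 2 ^ j))) else 0)"
      by (rule sum.cong[OF refl])
        (use j wedge_annihilate[OF _ _ ly] in \<open>auto simp: K_def\<close>)
    also have "\<dots> = (\<Sum>A | A \<in> {..<2 ^ N} \<and> j \<notin> set_decode A.
         x $ j * w A * ((- 1) ^ pos j (A + 2 ^ j) * cnj (wedge N ys $ (A + 2 ^ j))))"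
      by (subst sum.inter_filter) auto
    finally show "(\<Sum>A<2 ^ N. x $ j * w A * cnj (K j A)) =
       (\<Sum>A | A < 2 ^ N \<and> j \<notin> set_decode A.
         x $ j * w A * ((- 1) ^ pos j (A + 2 ^ j) * cnj (wedge N ys $ (A + 2 ^ j))))"
      by simp
  qed
  also have "\<dots> = (\<Sum>(j, A)\<in>Sigma {..<N} (\<lambda>j. {A. A < 2 ^ N \<and> j \<notin> set_decode A}).
       x $ j * w A * ((- 1) ^ pos j (A + 2 ^ j) * cnj (wedge N ys $ (A + 2 ^ j))))"
    by (rule sum.Sigma) auto
  also have "\<dots> = (\<Sum>(B, j)\<in>Sigma {..<2 ^ N} set_decode.
       (- 1) ^ pos j B * x $ j * w (B - 2 ^ j) * cnj (wedge N ys $ B))"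
    by (rule sum.reindex_bij_witness[where i = "\<lambda>(B, j). (j, B - 2 ^ j)" and j = "\<lambda>(j, A). (A + 2 ^ j, j)"])
      (auto simp: set_decode_add set_decode_diff add_power_less power_le_of_mem
         intro: set_decode_less)
  also have "\<dots> = (\<Sum>B<2 ^ N. \<Sum>j\<in>set_decode B.
       (- 1) ^ pos j B * x $ j * w (B - 2 ^ j) * cnj (wedge N ys $ B))"
    by (rule sum.Sigma[symmetric]) auto
  also have "\<dots> = wedge N (x # xs) \<bullet>c wedge N ys"
    by (simp add: inner_sum[of _ "2 ^ N"] wedge_Cons_index w_def sum_distrib_right)
  finally show ?case by simp
qed

subsection \<open>Functional calculus\<close>

lemma mat_adjoint_dim [simp]:
  "dim_row (mat_adjoint A) = dim_col A" "dim_col (mat_adjoint A) = dim_row A"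
  by (simp_all add: mat_adjoint_def)

lemma mat_adjoint_carrier [simp]: "A \<in> carrier_mat m n \<Longrightarrow> mat_adjoint A \<in> carrier_mat n m"
  by auto

lemma mat_adjoint_index:
  "i < dim_col A \<Longrightarrow> j < dim_row A \<Longrightarrow> mat_adjoint A $$ (i, j) = conjugate (A $$ (j, i))"
  by (simp add: mat_adjoint_def mat_of_rows_index)

lemma mat_adjoint_mult:
  fixes A B :: "complex mat"
  assumes "A \<in> carrier_mat m n" "B \<in> carrier_mat n l"
  shows "mat_adjoint (A * B) = mat_adjoint B * mat_adjoint A"
  by (rule eq_matI) (use assms in \<open>auto simp: mat_adjoint_index scalar_prod_def mult.commute\<close>)

lemma mat_adjoint_adjoint [simp]: "mat_adjoint (mat_adjoint A) = (A :: complex mat)"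
  by (rule eq_matI) (auto simp: mat_adjoint_index)

lemma unitary_right:
  fixes U :: "complex mat"
  assumes "U \<in> carrier_mat n n" "mat_adjoint U * U = 1\<^sub>m n"
  shows "U * mat_adjoint U = 1\<^sub>m n"
  using mat_mult_left_right_inverse[of "mat_adjoint U" n U] assms by simp

theorem hermitian_fun_eq:
  assumes UD: "spectral_decomp A U d"
  shows "hermitian_fun f A
       = U * mat_diag (dim_row A) (\<lambda>i. complex_of_real (f (d i))) * mat_adjoint U"
proof -
  define n where "n = dim_row A"
  define D where "D = (\<lambda>d :: nat \<Rightarrow> real. mat_diag n (\<lambda>i. complex_of_real (d i)))"
  have D: "D d \<in> carrier_mat n n" for d by (simp add: D_def)
  have "V * D (\<lambda>i. f (e i)) * mat_adjoint V = U * D (\<lambda>i. f (d i)) * mat_adjoint U"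
    if VE: "spectral_decomp A V e" for V e
  proof -
    have U: "U \<in> carrier_mat n n" and U1: "mat_adjoint U * U = 1\<^sub>m n"
      and AU: "A = U * D d * mat_adjoint U"
      using UD by (auto simp: spectral_decomp_def n_def D_def)
    have V: "V \<in> carrier_mat n n" and V1: "mat_adjoint V * V = 1\<^sub>m n"
      and AV: "A = V * D e * mat_adjoint V"
      using VE by (auto simp: spectral_decomp_def n_def D_def)
    have aU: "mat_adjoint U \<in> carrier_mat n n" and aV: "mat_adjoint V \<in> carrier_mat n n"
      using U V by auto
    note UU = unitary_right[OF U U1] and VV = unitary_right[OF V V1]
    define W where "W = mat_adjoint V * U"
    have W: "W \<in> carrier_mat n n" using aV U by (simp add: W_def)
    have l: "mat_adjoint V * (U * D g * mat_adjoint U) * U = W * D g" for g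
    proof -
      have "mat_adjoint V * (U * D g * mat_adjoint U) * U
          = W * D g * (mat_adjoint U * U)"
        unfolding W_def using U aU aV D[of g]
        by (simp add: assoc_mult_mat[of _ n n _ n _ n] mult_carrier_mat[of _ n n _ n])
      then show ?thesis using W D[of g] U1 by simp
    qed
    have r: "mat_adjoint V * (V * D g * mat_adjoint V) * U = D g * W" for g
    proof -
      have "mat_adjoint V * (V * D g * mat_adjoint V) * U
          = (mat_adjoint V * V) * D g * W"
        unfolding W_def using U V aV D[of g]
        by (simp add: assoc_mult_mat[of _ n n _ n _ n] mult_carrier_mat[of _ n n _ n])
      then show ?thesis using W D[of g] V1 by simp
    qed
    have eq: "W * D d = D e * W" using l[of d] r[of e] AU AV by simp
    have "W * D (\<lambda>i. f (d i)) = D (\<lambda>i. f (e i)) * W"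
    proof (rule eq_matI)
      fix i j assume "i < dim_row (D (\<lambda>i. f (e i)) * W)" "j < dim_col (D (\<lambda>i. f (e i)) * W)"
      then have ij: "i < n" "j < n" using W by (simp_all add: D_def mat_diag_def)
      have "W $$ (i, j) * d j = e i * W $$ (i, j)"
        using arg_cong[OF eq, of "\<lambda>M. M $$ (i, j)"] ij
        unfolding D_def mat_diag_mult_left[OF W] mat_diag_mult_right[OF W] by simp
      then have "W $$ (i, j) = 0 \<or> d j = e i" by auto
      then show "(W * D (\<lambda>i. f (d i))) $$ (i, j) = (D (\<lambda>i. f (e i)) * W) $$ (i, j)"
        unfolding D_def mat_diag_mult_left[OF W] mat_diag_mult_right[OF W] using ij by auto
    qed (use W in \<open>simp_all add: D_def mat_diag_def\<close>)
    then have *: "V * (W * D (\<lambda>i. f (d i))) * mat_adjoint U = V * (D (\<lambda>i. f (e i)) * W) * mat_adjoint U"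
      by simp
    let ?Y = "U * D (\<lambda>i. f (d i)) * mat_adjoint U"
    let ?Z = "V * D (\<lambda>i. f (e i)) * mat_adjoint V"
    have c: "?Y \<in> carrier_mat n n" "?Z \<in> carrier_mat n n"
      using mult_carrier_mat[OF mult_carrier_mat[OF U D] aU] mult_carrier_mat[OF mult_carrier_mat[OF V D] aV]
      by blast+
    have y: "V * (W * D (\<lambda>i. f (d i))) * mat_adjoint U = (V * mat_adjoint V) * ?Y"
      unfolding W_def using U V aU aV D
      by (simp add: assoc_mult_mat[of _ n n _ n _ n] mult_carrier_mat[of _ n n _ n])
    have z: "V * (D (\<lambda>i. f (e i)) * W) * mat_adjoint U = ?Z * (U * mat_adjoint U)"
      unfolding W_def using U V aU aV D
      by (simp add: assoc_mult_mat[of _ n n _ n _ n] mult_carrier_mat[of _ n n _ n])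
    show ?thesis
      using y z unfolding * UU VV left_mult_one_mat[OF c(1)] right_mult_one_mat[OF c(2)] by simp
  qed
  then show ?thesis
    unfolding hermitian_fun_def n_def[symmetric] D_def
    by (intro the_equality) (use UD in blast)+
qed

lemma hermitian_eigen_step:
  assumes A: "(A :: complex mat) \<in> carrier_mat (Suc m) (Suc m)" and herm: "mat_adjoint A = A"
  shows "\<exists>U e A3. U \<in> carrier_mat (Suc m) (Suc m) \<and> mat_adjoint U * U = 1\<^sub>m (Suc m) \<and>
     A3 \<in> carrier_mat m m \<and> mat_adjoint A3 = A3 \<and>
     mat_adjoint U * A * U
       = four_block_mat (mat 1 1 (\<lambda>_. complex_of_real e)) (0\<^sub>m 1 m) (0\<^sub>m m 1) A3"
proof -
  let ?n = "Suc m"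
  obtain es where cp: "char_poly A = (\<Prod>e\<leftarrow>es. [:- e, 1:])" and les: "length es = ?n"
    using char_poly_factorized[OF A] by blast
  obtain e es' where es: "es = e # es'" using les by (cases es) auto
  have ev: "eigenvalue A e"
    unfolding eigenvalue_root_char_poly[OF A] cp es by simp
  then obtain v where "eigenvector A v e" unfolding eigenvalue_def by blast
  then have v: "v \<in> carrier_vec ?n" and v0: "v \<noteq> 0\<^sub>v ?n" and Av: "A *\<^sub>v v = e \<cdot>\<^sub>v v"
    using A by (auto simp: eigenvector_def)
  define b where "b = basis_completion v"
  define ws where "ws = gram_schmidt ?n b"
  interpret cof_vec_space ?n "TYPE(complex)" .
  from basis_completion[OF v v0, folded b_def]
  have dist_b: "distinct b" and indep: "\<not> lin_dep (set b)" and bc: "set b \<subseteq> carrier_vec ?n"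
    and hdb: "hd b = v" and len_b: "length b = ?n" by auto
  from hdb len_b obtain vs where bv: "b = v # vs" by (cases b, auto)
  from gram_schmidt_result[OF bc dist_b indep refl, folded ws_def]
  have ws: "set ws \<subseteq> carrier_vec ?n" "corthogonal ws" "length ws = ?n"
    by (auto simp: len_b)
  have "hd ws = v" using gram_schmidt_hd[OF v, of vs, folded bv] unfolding ws_def .
  then have ws0: "ws ! 0 = v" using ws(3) by (cases ws) auto
  have wsc: "ws ! i \<in> carrier_vec ?n" if "i < ?n" for i
    using ws that by (metis nth_mem subsetD)
  have inner: "ws ! i \<bullet>c ws ! j = (\<Sum>r<?n. ws ! i $ r * cnj (ws ! j $ r))" if "j < ?n" for i j
    using inner_sum[OF wsc[OF that]] .
  define q where "q = (\<lambda>i. \<Sum>r<?n. (cmod (ws ! i $ r))\<^sup>2)"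
  have qi: "ws ! i \<bullet>c ws ! i = complex_of_real (q i)" if "i < ?n" for i
    unfolding inner[OF that] q_def of_real_sum
    by (rule sum.cong[OF refl]) (rule complex_norm_square[symmetric])
  have q0: "q i > 0" if "i < ?n" for i
  proof -
    have "q i \<ge> 0" unfolding q_def by (simp add: sum_nonneg)
    moreover have "ws ! i \<bullet>c ws ! i \<noteq> 0"
      using corthogonalD[OF ws(2), of i i] ws(3) that by simp
    ultimately show ?thesis using qi[OF that] by (cases "q i = 0") auto
  qed
  define U where "U = mat ?n ?n (\<lambda>(r, i). ws ! i $ r / complex_of_real (sqrt (q i)))"
  have U: "U \<in> carrier_mat ?n ?n" by (simp add: U_def)
  have U1: "mat_adjoint U * U = 1\<^sub>m ?n"
  proof (rule eq_matI)
    fix i j assume "i < dim_row (1\<^sub>m ?n :: complex mat)" "j < dim_col (1\<^sub>m ?n :: complex mat)"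
    then have ij: "i < ?n" "j < ?n" by auto
    have "(mat_adjoint U * U) $$ (i, j) = (\<Sum>r<?n. mat_adjoint U $$ (i, r) * U $$ (r, j))"
      using ij U by (auto simp: scalar_prod_def lessThan_atLeast0)
    also have "\<dots> = (\<Sum>r<?n. ws ! j $ r * cnj (ws ! i $ r) / (complex_of_real (sqrt (q i)) * complex_of_real (sqrt (q j))))"
      by (rule sum.cong[OF refl]) (use ij U in \<open>auto simp: mat_adjoint_index U_def\<close>)
    also have "\<dots> = (ws ! j \<bullet>c ws ! i) / (complex_of_real (sqrt (q i)) * complex_of_real (sqrt (q j)))"
      unfolding inner[OF ij(1)] sum_divide_distrib ..
    also have "\<dots> = 1\<^sub>m ?n $$ (i, j)"
    proof (cases "i = j")
      case True
      have "complex_of_real (sqrt (q i)) * complex_of_real (sqrt (q i)) = complex_of_real (q i)"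
        using q0[OF ij(1)] by (simp flip: of_real_mult)
      then show ?thesis using True ij q0[OF ij(1)] qi[OF ij(1)] by simp
    next
      case False
      then have "ws ! j \<bullet>c ws ! i = 0"
        using corthogonalD[OF ws(2), of j i] ws(3) ij by simp
      then show ?thesis using False ij by simp
    qed
    finally show "(mat_adjoint U * U) $$ (i, j) = 1\<^sub>m ?n $$ (i, j)" .
  qed (use U in auto)
  have aU: "mat_adjoint U \<in> carrier_mat ?n ?n" using U by auto
  define A' where "A' = mat_adjoint U * A * U"
  have A': "A' \<in> carrier_mat ?n ?n" using mult_carrier_mat[OF mult_carrier_mat[OF aU A] U] by (simp add: A'_def)
  have hA': "mat_adjoint A' = A'"
  proof -
    have "mat_adjoint A' = mat_adjoint U * mat_adjoint (mat_adjoint U * A)"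
      unfolding A'_def by (rule mat_adjoint_mult) (use A U aU in auto)
    also have "mat_adjoint (mat_adjoint U * A) = A * U"
      using mat_adjoint_mult[OF aU A] herm by simp
    finally show ?thesis
      unfolding A'_def using A U aU by (simp add: assoc_mult_mat[of _ ?n ?n _ ?n _ ?n] mult_carrier_mat[of _ ?n ?n _ ?n])
  qed
  have cU: "col U 0 = (1 / complex_of_real (sqrt (q 0))) \<cdot>\<^sub>v v"
    by (rule eq_vecI) (use v ws0 in \<open>auto simp: U_def\<close>)
  have "A *\<^sub>v col U 0 = e \<cdot>\<^sub>v col U 0"
    unfolding cU mult_mat_vec[OF A v] Av by (simp add: smult_smult_assoc mult.commute)
  then have cAU: "col (A * U) 0 = e \<cdot>\<^sub>v col U 0"
    using A U by (subst col_mult2[of A ?n ?n U ?n]) auto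
  have col0: "A' $$ (i, 0) = (if i = 0 then e else 0)" if i: "i < ?n" for i
  proof -
    have "A' $$ (i, 0) = (mat_adjoint U * (A * U)) $$ (i, 0)"
      unfolding A'_def using A U aU by (simp add: assoc_mult_mat[of _ ?n ?n _ ?n _ ?n] mult_carrier_mat[of _ ?n ?n _ ?n])
    also have "\<dots> = row (mat_adjoint U) i \<bullet> (e \<cdot>\<^sub>v col U 0)"
      using A U aU i cAU by (subst index_mult_mat) auto
    also have "\<dots> = e * (row (mat_adjoint U) i \<bullet> col U 0)"
      by (rule scalar_prod_smult_right) (use U aU in auto)
    also have "row (mat_adjoint U) i \<bullet> col U 0 = (mat_adjoint U * U) $$ (i, 0)"
      using U aU i by (subst index_mult_mat) auto
    finally show ?thesis unfolding U1 using i by simp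
  qed
  have herm_ij: "A' $$ (i, j) = cnj (A' $$ (j, i))" if "i < ?n" "j < ?n" for i j
    using arg_cong[OF hA', of "\<lambda>M. M $$ (i, j)"] that A' by (simp add: mat_adjoint_index)
  have e': "e = cnj e"
    using herm_ij[OF zero_less_Suc zero_less_Suc, unfolded col0[OF zero_less_Suc]]
    by (simp only: if_True refl)
  have row0: "A' $$ (0, i) = (if i = 0 then e else 0)" if i: "i < ?n" for i
    using herm_ij[OF zero_less_Suc i] col0[OF i] e'[symmetric]
    by (cases "i = 0") (simp_all only: if_True if_False refl complex_cnj_zero)
  have e: "e = complex_of_real (Re e)"
    using arg_cong[OF e', of Im] by (simp add: complex_eq_iff)
  define A3 where "A3 = mat m m (\<lambda>(i, j). A' $$ (Suc i, Suc j))"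
  have A3: "A3 \<in> carrier_mat m m" by (simp add: A3_def)
  have "mat_adjoint A3 = A3"
    by (rule eq_matI) (auto simp: mat_adjoint_index A3_def herm_ij[symmetric])
  moreover have "A' = four_block_mat (mat 1 1 (\<lambda>_. complex_of_real (Re e))) (0\<^sub>m 1 m) (0\<^sub>m m 1) A3"
    unfolding e[symmetric] by (rule eq_matI) (use A' col0 row0 in \<open>auto simp: A3_def\<close>)
  ultimately show ?thesis
    using U U1 A3 unfolding A'_def by blast
qed

theorem hermitian_spectral:
  assumes "A \<in> carrier_mat n n" "mat_adjoint A = A"
  shows "\<exists>U d. spectral_decomp A U d"
  using assms
proof (induction n arbitrary: A)
  case 0
  then have "spectral_decomp A (1\<^sub>m 0) (\<lambda>_. 0)"
    unfolding spectral_decomp_def by auto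
  then show ?case by blast
next
  case (Suc m)
  let ?n = "Suc m"
  note A = Suc.prems(1)
  obtain U e A3 where U: "U \<in> carrier_mat ?n ?n" and U1: "mat_adjoint U * U = 1\<^sub>m ?n"
    and A3: "A3 \<in> carrier_mat m m" "mat_adjoint A3 = A3"
    and blk: "mat_adjoint U * A * U
       = four_block_mat (mat 1 1 (\<lambda>_. complex_of_real e)) (0\<^sub>m 1 m) (0\<^sub>m m 1) A3"
    using hermitian_eigen_step[OF Suc.prems] by blast
  obtain V d where "spectral_decomp A3 V d" using Suc.IH[OF A3] by blast
  then have V: "V \<in> carrier_mat m m" and V1: "mat_adjoint V * V = 1\<^sub>m m"
    and A3V: "A3 = V * mat_diag m (\<lambda>i. complex_of_real (d i)) * mat_adjoint V"
    using A3 by (auto simp: spectral_decomp_def)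
  have aV: "mat_adjoint V \<in> carrier_mat m m" using V by auto
  have aU: "mat_adjoint U \<in> carrier_mat ?n ?n" using U by auto
  define P where "P = four_block_mat (1\<^sub>m 1) (0\<^sub>m 1 m) (0\<^sub>m m 1) V"
  define d' where "d' = (\<lambda>i. if i = 0 then e else d (i - 1))"
  define D where "D = mat_diag ?n (\<lambda>i. complex_of_real (d' i))"
  have P: "P \<in> carrier_mat ?n ?n" using V by (auto simp: P_def)
  have aP: "mat_adjoint P \<in> carrier_mat ?n ?n" using P by auto
  have D: "D \<in> carrier_mat ?n ?n" by (simp add: D_def)
  have aPb: "mat_adjoint P = four_block_mat (1\<^sub>m 1) (0\<^sub>m 1 m) (0\<^sub>m m 1) (mat_adjoint V)"
    by (rule eq_matI) (use V in \<open>auto simp: mat_adjoint_index P_def\<close>)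
  have Db: "D = four_block_mat (mat 1 1 (\<lambda>_. complex_of_real e)) (0\<^sub>m 1 m) (0\<^sub>m m 1)
      (mat_diag m (\<lambda>i. complex_of_real (d i)))"
    by (rule eq_matI) (auto simp: D_def d'_def mat_diag_def)
  have P1: "mat_adjoint P * P = 1\<^sub>m ?n"
  proof -
    have "mat_adjoint P * P = four_block_mat (1\<^sub>m 1) (0\<^sub>m 1 m) (0\<^sub>m m 1) (1\<^sub>m m)"
      unfolding aPb unfolding P_def
      by (subst mult_four_block_mat[where ?nr1.0 = 1 and ?nr2.0 = m and ?n1.0 = 1 and ?n2.0 = m
            and ?nc1.0 = 1 and ?nc2.0 = m], use V aV in \<open>simp_all add: V1\<close>)
    also have "\<dots> = 1\<^sub>m ?n" by (rule eq_matI) auto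
    finally show ?thesis .
  qed
  have m11: "mat 1 1 (\<lambda>_. complex_of_real e) \<in> carrier_mat 1 1"
    "mat_diag m (\<lambda>i. complex_of_real (d i)) \<in> carrier_mat m m" by auto
  have PDb: "P * D = four_block_mat (mat 1 1 (\<lambda>_. complex_of_real e)) (0\<^sub>m 1 m) (0\<^sub>m m 1)
      (V * mat_diag m (\<lambda>i. complex_of_real (d i)))"
    unfolding Db P_def
    by (subst mult_four_block_mat[where ?nr1.0 = 1 and ?nr2.0 = m and ?n1.0 = 1 and ?n2.0 = m
          and ?nc1.0 = 1 and ?nc2.0 = m], use V m11 left_mult_zero_mat[OF m11(2)] in auto)
  define M where "M = V * mat_diag m (\<lambda>i. complex_of_real (d i))"
  have M: "M \<in> carrier_mat m m" unfolding M_def by (rule mult_carrier_mat[OF V m11(2)])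
  have R: "M * mat_adjoint V \<in> carrier_mat m m" by (rule mult_carrier_mat[OF M aV])
  have PDP: "P * D * mat_adjoint P = mat_adjoint U * A * U"
    unfolding PDb aPb blk A3V M_def[symmetric]
    by (subst mult_four_block_mat[where ?nr1.0 = 1 and ?nr2.0 = m and ?n1.0 = 1 and ?n2.0 = m
          and ?nc1.0 = 1 and ?nc2.0 = m],
        use M aV m11 left_mult_zero_mat[OF aV] right_mult_zero_mat[OF M] left_add_zero_mat[OF R] in auto)
  note as = assoc_mult_mat[of _ ?n ?n _ ?n _ ?n] mult_carrier_mat[of _ ?n ?n _ ?n]
  note UU = unitary_right[OF U U1]
  have aUP: "mat_adjoint (U * P) = mat_adjoint P * mat_adjoint U"
    by (rule mat_adjoint_mult[OF U P])
  have "mat_adjoint (U * P) * (U * P) = mat_adjoint P * ((mat_adjoint U * U) * P)"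
    unfolding aUP using U aU P aP by (simp add: as)
  also have "\<dots> = 1\<^sub>m ?n" unfolding U1 using P P1 by simp
  finally have un: "mat_adjoint (U * P) * (U * P) = 1\<^sub>m ?n" .
  have "U * P * D * mat_adjoint (U * P) = U * (P * D * mat_adjoint P) * mat_adjoint U"
    unfolding aUP using U aU P aP D by (simp add: as)
  also have "\<dots> = (U * mat_adjoint U) * (A * (U * mat_adjoint U))"
    unfolding PDP using U aU A by (simp add: as)
  also have "\<dots> = A" unfolding UU using A by simp
  finally have "spectral_decomp A (U * P) d'"
    unfolding spectral_decomp_def using un A U P by (auto simp: D_def)
  then show ?case by blast
qed

lemma spectral_decomp_hermitian:
  assumes "spectral_decomp A U d"
  shows "mat_adjoint A = A"
proof -
  define n where "n = dim_row A"
  define D where "D = mat_diag n (\<lambda>i. complex_of_real (d i))"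
  have U: "U \<in> carrier_mat n n" and A: "A = U * D * mat_adjoint U"
    using assms by (auto simp: spectral_decomp_def n_def D_def)
  have D: "D \<in> carrier_mat n n" by (simp add: D_def)
  have aU: "mat_adjoint U \<in> carrier_mat n n" using U by auto
  have aD: "mat_adjoint D = D"
    by (rule eq_matI) (auto simp: D_def mat_diag_def mat_adjoint_index)
  have "mat_adjoint A = mat_adjoint (mat_adjoint U) * mat_adjoint (U * D)"
    unfolding A by (rule mat_adjoint_mult[OF mult_carrier_mat[OF U D] aU])
  also have "\<dots> = U * (D * mat_adjoint U)"
    using mat_adjoint_mult[OF U D] aD by simp
  also have "\<dots> = A"
    unfolding A by (rule assoc_mult_mat[OF U D aU, symmetric])
  finally show ?thesis .
qed

lemma spectral_decomp_hermitian_fun: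
  assumes "spectral_decomp A U d"
  shows "spectral_decomp (hermitian_fun f A) U (\<lambda>i. f (d i))"
  using assms unfolding hermitian_fun_eq[OF assms] by (auto simp: spectral_decomp_def)

subsection \<open>Fermions, matrices of operators\<close>

lemma block_block_mat:
  assumes "i < k" "j < k" "x i j \<in> carrier_mat (2 ^ N) (2 ^ N)"
  shows "block N (block_mat N k x) i j = x i j"
proof -
  have lt: "a * 2 ^ N + r < k * 2 ^ N" if "a < k" "r < 2 ^ N" for a r :: nat
  proof -
    have "a * 2 ^ N + r < Suc a * 2 ^ N" using that(2) by simp
    also have "\<dots> \<le> k * 2 ^ N" using that(1) by (intro mult_right_mono) auto
    finally show ?thesis .
  qed
  show ?thesis
    by (rule eq_matI) (use assms lt in \<open>auto simp: block_def block_mat_def\<close>)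
qed

lemma fermion_carrier [simp]: "fermion N j \<in> carrier_mat (2 ^ N) (2 ^ N)"
  by (simp add: fermion_def)

lemma fermion_dim [simp]: "dim_row (fermion N j) = 2 ^ N" "dim_col (fermion N j) = 2 ^ N"
  using fermion_carrier[of N j] by blast+

lemma mult_unit_vec:
  "M \<in> carrier_mat nr n \<Longrightarrow> i < n \<Longrightarrow> M *\<^sub>v unit_vec n i = (col M i :: complex vec)"
  by (rule eq_vecI) auto

lemma fermion_lowest:
  assumes A: "A < 2 ^ N" and j: "j < N" and low: "\<And>i. i \<in> set_decode A \<Longrightarrow> j < i"
  shows "fermion N j *\<^sub>v unit_vec (2 ^ N) A = unit_vec (2 ^ N) (A + 2 ^ j)"
proof -
  have nj: "j \<notin> set_decode A" using low by blast
  note AB = add_power_less[OF A j nj]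
  have pos: "pos j (A + 2 ^ j) = 0"
    using low nj by (fastforce simp: pos_def set_decode_add)
  have "fermion N j *\<^sub>v unit_vec (2 ^ N) A = col (fermion N j) A"
    by (rule mult_unit_vec[OF fermion_carrier A])
  also have "\<dots> = unit_vec (2 ^ N) (A + 2 ^ j)"
  proof (rule eq_vecI)
    fix B assume "B < dim_vec (unit_vec (2 ^ N) (A + 2 ^ j) :: complex vec)"
    then have B: "B < 2 ^ N" by simp
    have "j \<in> set_decode B \<and> A = B - 2 ^ j \<longleftrightarrow> B = A + 2 ^ j"
      using nj power_le_of_mem[of j B] by (auto simp: set_decode_add)
    then show "col (fermion N j) A $ B = unit_vec (2 ^ N) (A + 2 ^ j) $ B"
      using A B AB nj pos
      by (auto simp: fermion_def mat_adjoint_index creation_index unit_vec_index)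
  qed (auto simp: fermion_def)
  finally show ?thesis .
qed

lemma fermion_prod_carrier [simp]: "fermion_prod n \<in> carrier_mat (2 ^ (2 * n)) (2 ^ (2 * n))"
proof -
  have "foldr (*) (map (fermion N) js) (1\<^sub>m (2 ^ N)) \<in> carrier_mat (2 ^ N) (2 ^ N)" for N js
    by (induction js) (auto intro: mult_carrier_mat[of _ _ "2 ^ N"])
  then show ?thesis by (simp add: fermion_prod_def)
qed

lemma fermion_prod_dim [simp]:
  "dim_row (fermion_prod n) = 2 ^ (2 * n)" "dim_col (fermion_prod n) = 2 ^ (2 * n)"
  using fermion_prod_carrier[of n] by blast+

lemma fermion_prod_vacuum:
  "fermion_prod n *\<^sub>v unit_vec (2 ^ (2 * n)) 0 = unit_vec (2 ^ (2 * n)) (set_encode {..<2 * n})"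
proof -
  define N where "N = 2 * n"
  have "foldr (*) (map (fermion N) [N - m..<N]) (1\<^sub>m (2 ^ N)) \<in> carrier_mat (2 ^ N) (2 ^ N) \<and>
     foldr (*) (map (fermion N) [N - m..<N]) (1\<^sub>m (2 ^ N)) *\<^sub>v unit_vec (2 ^ N) 0
     = unit_vec (2 ^ N) (set_encode {N - m..<N})" if "m \<le> N" for m
    using that
  proof (induction m)
    case 0
    then show ?case by simp
  next
    case (Suc m)
    define j where "j = N - Suc m"
    have j: "j < N" "Suc j = N - m" using Suc.prems by (auto simp: j_def)
    let ?A = "set_encode {Suc j..<N}"
    let ?M = "foldr (*) (map (fermion N) [Suc j..<N]) (1\<^sub>m (2 ^ N))"
    have IH: "?M \<in> carrier_mat (2 ^ N) (2 ^ N)"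
      "?M *\<^sub>v unit_vec (2 ^ N) 0 = unit_vec (2 ^ N) ?A"
      using Suc j by simp_all
    have up: "[j..<N] = j # [Suc j..<N]" using j by (simp add: upt_conv_Cons)
    have se: "set_encode {j..<N} = ?A + 2 ^ j"
    proof -
      have "{j..<N} = insert j {Suc j..<N}" using j by auto
      then show ?thesis by simp
    qed
    have "?A < 2 ^ N" by (rule set_encode_less) auto
    then have "fermion N j *\<^sub>v unit_vec (2 ^ N) ?A = unit_vec (2 ^ N) (?A + 2 ^ j)"
      by (rule fermion_lowest) (use j in auto)
    then show ?case
      unfolding j_def[symmetric] up se using IH
      by (simp add: assoc_mult_mat_vec[OF fermion_carrier IH(1) unit_vec_carrier]
          mult_carrier_mat[OF fermion_carrier IH(1)])
  qed
  from this[of N] show ?thesis by (simp add: fermion_prod_def N_def lessThan_atLeast0)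
qed

lemma F_sum_index:
  assumes "r < 2 ^ N" "s < 2 ^ N"
  shows "foldr (+) (map (\<lambda>j. b j \<cdot>\<^sub>m fermion N j) js) (0\<^sub>m (2 ^ N) (2 ^ N)) $$ (r, s)
       = (\<Sum>j\<leftarrow>js. b j * fermion N j $$ (r, s))"
    and "foldr (+) (map (\<lambda>j. b j \<cdot>\<^sub>m fermion N j) js) (0\<^sub>m (2 ^ N) (2 ^ N))
       \<in> carrier_mat (2 ^ N) (2 ^ N)"
proof -
  have "foldr (+) (map (\<lambda>j. b j \<cdot>\<^sub>m fermion N j) js) (0\<^sub>m (2 ^ N) (2 ^ N))
       \<in> carrier_mat (2 ^ N) (2 ^ N) \<and>
     foldr (+) (map (\<lambda>j. b j \<cdot>\<^sub>m fermion N j) js) (0\<^sub>m (2 ^ N) (2 ^ N)) $$ (r, s)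
       = (\<Sum>j\<leftarrow>js. b j * fermion N j $$ (r, s))"
    using assms by (induction js) auto
  then show "foldr (+) (map (\<lambda>j. b j \<cdot>\<^sub>m fermion N j) js) (0\<^sub>m (2 ^ N) (2 ^ N)) $$ (r, s)
       = (\<Sum>j\<leftarrow>js. b j * fermion N j $$ (r, s))"
    "foldr (+) (map (\<lambda>j. b j \<cdot>\<^sub>m fermion N j) js) (0\<^sub>m (2 ^ N) (2 ^ N))
       \<in> carrier_mat (2 ^ N) (2 ^ N)" by auto
qed

lemma F_comb_carrier [simp]: "F_comb n a b c \<in> carrier_mat (2 ^ (2 * n)) (2 ^ (2 * n))"
  unfolding F_comb_def using F_sum_index(2)[of 0 "2 * n" 0] by auto

lemma F_comb_dim [simp]:
  "dim_row (F_comb n a b c) = 2 ^ (2 * n)" "dim_col (F_comb n a b c) = 2 ^ (2 * n)"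
  using F_comb_carrier[of n a b c] by blast+

lemma F_comb_index:
  assumes "r < 2 ^ (2 * n)" "s < 2 ^ (2 * n)"
  shows "F_comb n a b c $$ (r, s) = a * (if r = s then 1 else 0)
     + (\<Sum>j<2 * n. b j * fermion (2 * n) j $$ (r, s)) + c * fermion_prod n $$ (r, s)"
  using assms F_sum_index[OF assms, of b "[0..<2 * n]"]
  unfolding F_comb_def
  by (simp add: carrier_matD[of _ "2 ^ (2 * n)" "2 ^ (2 * n)"] interv_sum_list_conv_sum_set_nat lessThan_atLeast0)

lemma fermion_prod_in_algebra: "fermion_prod n \<in> fermion_algebra (2 * n)"
proof -
  have "foldr (*) (map (fermion N) js) (1\<^sub>m (2 ^ N)) \<in> fermion_algebra N" if "set js \<subseteq> {..<N}" for N js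
    using that by (induction js) (auto intro: fermion_algebra.intros)
  from this[of "[0..<2 * n]" "2 * n"] show ?thesis by (simp add: fermion_prod_def lessThan_atLeast0)
qed

theorem F_space_subset: "F_space n \<subseteq> fermion_algebra (2 * n)"
proof -
  have z: "0\<^sub>m (2 ^ N) (2 ^ N) \<in> fermion_algebra N" for N
  proof -
    have "0\<^sub>m (2 ^ N) (2 ^ N) = (0 :: complex) \<cdot>\<^sub>m 1\<^sub>m (2 ^ N)" by (rule eq_matI) auto
    then show ?thesis by (simp add: fermion_algebra.intros)
  qed
  have s: "foldr (+) (map (\<lambda>j. b j \<cdot>\<^sub>m fermion N j) js) (0\<^sub>m (2 ^ N) (2 ^ N)) \<in> fermion_algebra N"
    if "set js \<subseteq> {..<N}" for N js b
    using that by (induction js) (auto intro: fermion_algebra.intros z)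
  then show ?thesis
    unfolding F_space_def F_comb_def
    by (auto simp: lessThan_atLeast0 intro!: fermion_algebra.add fermion_algebra.smult fermion_algebra.one
        fermion_prod_in_algebra s[of "[0..<2 * n]"])
qed

subsection \<open>The map \<open>\<tau>\<close>\<close>

lemma F_comb_column:
  assumes n: "n \<ge> 1" and r: "r < 2 ^ (2 * n)"
  shows "F_comb n a b c $$ (r, 0) = (if r = 0 then a else 0)
     + (\<Sum>j<2 * n. if r = 2 ^ j then b j else 0) + (if r = set_encode {..<2 * n} then c else 0)"
proof -
  have "fermion (2 * n) j $$ (r, 0) = (if r = 2 ^ j then 1 else 0)" if "j < 2 * n" for j
  proof -
    have "fermion (2 * n) j $$ (r, 0) = col (fermion (2 * n) j) 0 $ r"
      using r that by simp
    also have "col (fermion (2 * n) j) 0 = fermion (2 * n) j *\<^sub>v unit_vec (2 ^ (2 * n)) 0"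
      by (rule mult_unit_vec[symmetric]) auto
    also have "\<dots> = unit_vec (2 ^ (2 * n)) (2 ^ j)"
      using fermion_lowest[of 0 "2 * n" j] that by simp
    finally show ?thesis using r by (simp add: unit_vec_index)
  qed
  moreover have "fermion_prod n $$ (r, 0) = (if r = set_encode {..<2 * n} then 1 else 0)"
  proof -
    have "fermion_prod n $$ (r, 0) = col (fermion_prod n) 0 $ r"
      using r by simp
    also have "col (fermion_prod n) 0 = fermion_prod n *\<^sub>v unit_vec (2 ^ (2 * n)) 0"
      by (rule mult_unit_vec[symmetric]) auto
    finally show ?thesis using r by (simp add: fermion_prod_vacuum unit_vec_index)
  qed
  ultimately show ?thesis
    using r by (auto simp: F_comb_index intro!: sum.cong)
qed

lemma F_comb_eq_iff:
  assumes n: "n \<ge> 1"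
  shows "F_comb n a b c = F_comb n a' b' c' \<longleftrightarrow> a = a' \<and> (\<forall>j<2 * n. b j = b' j) \<and> c = c'"
proof
  assume eq: "F_comb n a b c = F_comb n a' b' c'"
  let ?F = "set_encode {..<2 * n}"
  have se: "2 ^ j = set_encode {j}" for j :: nat by (simp add: set_encode_def)
  have F: "?F < 2 ^ (2 * n)" by (rule set_encode_less) auto
  have F0: "?F \<noteq> 0" using n set_encode_eq[of "{..<2 * n}" "{}"] by (simp add: lessThan_empty_iff)
  have Fj: "?F \<noteq> 2 ^ j" for j
  proof
    assume "?F = 2 ^ j"
    then have "{..<2 * n} = {j}" unfolding se by (subst (asm) set_encode_eq) auto
    then have "card {..<2 * n} = card {j}" by (rule arg_cong)
    then show False by simp
  qed
  have j: "(2::nat) ^ j < 2 ^ (2 * n)" if "j < 2 * n" for j using that by simp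
  have inj: "(2::nat) ^ i = 2 ^ j \<longleftrightarrow> i = j" for i j by simp
  note col = F_comb_column[OF n]
  have "a = a'"
    using arg_cong[OF eq, of "\<lambda>M. M $$ (0, 0)"] F0 by (simp add: col)
  moreover have "c = c'"
    using arg_cong[OF eq, of "\<lambda>M. M $$ (?F, 0)"] F0 Fj F by (simp add: col)
  moreover have "b j = b' j" if "j < 2 * n" for j
    using arg_cong[OF eq, of "\<lambda>M. M $$ (2 ^ j, 0)"] j[OF that] Fj[of j] that
    by (simp add: col inj)
  ultimately show "a = a' \<and> (\<forall>j<2 * n. b j = b' j) \<and> c = c'" by blast
next
  assume "a = a' \<and> (\<forall>j<2 * n. b j = b' j) \<and> c = c'"
  then show "F_comb n a b c = F_comb n a' b' c'"
    by (intro eq_matI) (auto simp: F_comb_index)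
qed

theorem tau_F_comb:
  assumes n: "n \<ge> 1"
  shows "tau n (F_comb n a b c) = F_comb n a b (- c)"
  unfolding tau_def
  by (rule the_equality) (auto simp: F_comb_eq_iff[OF n])

theorem tau_F_space: "n \<ge> 1 \<Longrightarrow> x \<in> F_space n \<Longrightarrow> tau n x \<in> F_space n"
  unfolding F_space_def using tau_F_comb by blast

lemma F_comb_linear:
  "s \<cdot>\<^sub>m F_comb n a b c + t \<cdot>\<^sub>m F_comb n a' b' c'
     = F_comb n (s * a + t * a') (\<lambda>j. s * b j + t * b' j) (s * c + t * c')"
  by (intro eq_matI)
    (auto simp: F_comb_index sum.distrib sum_distrib_left
      algebra_simps)

theorem tau_linear:
  assumes "n \<ge> 1" "x \<in> F_space n" "y \<in> F_space n"
  shows "tau n (s \<cdot>\<^sub>m x + t \<cdot>\<^sub>m y) = s \<cdot>\<^sub>m tau n x + t \<cdot>\<^sub>m tau n y"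
  using assms by (auto simp: F_space_def F_comb_linear tau_F_comb)

lemma one_F_comb: "1\<^sub>m (2 ^ (2 * n)) = F_comb n 1 (\<lambda>_. 0) 0"
  by (intro eq_matI) (auto simp: F_comb_index)

lemma fermion_F_comb: "i < 2 * n \<Longrightarrow> fermion (2 * n) i = F_comb n 0 (\<lambda>j. if j = i then 1 else 0) 0"
  by (intro eq_matI)
    (auto simp: F_comb_index
      if_distrib[of "\<lambda>x. x * _"] cong: if_cong)

lemma fermion_prod_F_comb: "fermion_prod n = F_comb n 0 (\<lambda>_. 0) 1"
  by (intro eq_matI)
    (auto simp: F_comb_index)

lemma F_comb_uminus_prod: "- fermion_prod n = F_comb n 0 (\<lambda>_. 0) (- 1)"
  by (intro eq_matI)
    (auto simp: F_comb_index)

theorem tau_generators: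
  assumes "n \<ge> 1"
  shows "tau n (1\<^sub>m (2 ^ (2 * n))) = 1\<^sub>m (2 ^ (2 * n))"
    and "j < 2 * n \<Longrightarrow> tau n (fermion (2 * n) j) = fermion (2 * n) j"
    and "tau n (fermion_prod n) = - fermion_prod n"
  using assms
  by (simp_all add: one_F_comb fermion_F_comb F_comb_uminus_prod tau_F_comb)
    (simp add: fermion_prod_F_comb tau_F_comb)

end

theory Submission
  imports Defs "HOL-Real_Asymp.Real_Asymp"
begin

text \<open>
  For even \<open>p = 2m \<le> 2n\<close>, \<open>\<parallel>x\<parallel>\<^sub>p\<^sup>p\<close> is the trace of \<open>(x\<^sup>*x)\<^sup>m\<close>.  A word in the generators that contains
  \<open>\<Omega> = \<omega>\<^sub>1\<cdots>\<omega>\<^sub>2\<^sub>n\<close> an odd number of times has trace zero unless every \<open>\<omega>\<^sub>j\<close> occurs as well, which needs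
  more than \<open>2n\<close> letters; so the norm does not change when \<open>\<Omega>\<close> is replaced by \<open>-\<Omega>\<close>.

  Conversely, the operators \<open>\<omega>\<^sub>j \<otimes> \<omega>\<^sub>j\<close> are commuting symmetries and behave under the trace like
  independent Rademacher variables \<open>\<epsilon>\<^sub>j\<close>, with \<open>\<Omega> \<otimes> \<Omega>\<close> corresponding to \<open>\<Prod>\<epsilon>\<^sub>j\<close>.  Hence
  \<open>\<parallel>\<tau>\<parallel>\<^sub>c\<^sub>b \<le> 1\<close> forces \<open>E \<bar>a + \<Sum>\<epsilon>\<^sub>j/2 + \<Prod>\<epsilon>\<^sub>j\<bar>\<^sup>p = E \<bar>a + \<Sum>\<epsilon>\<^sub>j/2 - \<Prod>\<epsilon>\<^sub>j\<bar>\<^sup>p\<close> for all integers \<open>a\<close>.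
  This says that the \<open>2n\<close>-th difference of \<open>H(u) = \<bar>u + 1\<bar>\<^sup>p - \<bar>u - 1\<bar>\<^sup>p\<close> vanishes on the integers, so
  that \<open>H\<close> is a polynomial of degree less than \<open>2n\<close> there.  Since \<open>H\<close> is odd and grows like
  \<open>2p u\<^sup>p\<^sup>-\<^sup>1\<close>, its degree is \<open>p - 1\<close> and odd.
\<close>

section \<open>Finite differences\<close>

definition bdiff :: "(int \<Rightarrow> real) \<Rightarrow> int \<Rightarrow> real" where
  "bdiff F m = F m - F (m - 1)"

lemma sum_Pow_lessThan_Suc:
  fixes f :: "nat set \<Rightarrow> 'a :: comm_monoid_add"
  shows "(\<Sum>E\<in>Pow {..<Suc N}. f E) = (\<Sum>E\<in>Pow {..<N}. f E) + (\<Sum>E\<in>Pow {..<N}. f (insert N E))"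
proof -
  have "inj_on (insert N) (Pow {..<N})"
    by (rule inj_on_inverseI[where g = "\<lambda>E. E - {N}"]) auto
  then have "(\<Sum>E\<in>insert N ` Pow {..<N}. f E) = (\<Sum>E\<in>Pow {..<N}. f (insert N E))"
    by (simp add: sum.reindex)
  moreover have "Pow {..<N} \<inter> insert N ` Pow {..<N} = {}" by auto
  ultimately show ?thesis
    unfolding lessThan_Suc Pow_insert by (subst sum.union_disjoint) auto
qed

text \<open>Each of the \<open>N\<close> differences either takes its shift or not. Subsets are kept
  in place of binomial coefficients because the sign patterns below are indexed in the same
  way.\<close>

lemma bdiff_funpow:
  "(bdiff ^^ N) F m = (\<Sum>E\<in>Pow {..<N}. (- 1) ^ card E * F (m - int (card E)))"
proof (induction N arbitrary: m)
  case (Suc N)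
  have c: "card (insert N E) = Suc (card E)" if "E \<in> Pow {..<N}" for E
    using that finite_subset[of E "{..<N}"] by (subst card_insert_disjoint) auto
  show ?case
    by (simp add: sum_Pow_lessThan_Suc c Suc bdiff_def[of "(bdiff ^^ N) F"] sum_negf algebra_simps)
qed simp

lemma gbinomial_poly: "\<exists>P :: real poly. degree P \<le> k \<and> (\<forall>x. poly P x = x gchoose k)"
proof (intro exI conjI allI)
  let ?P = "smult (1 / fact k) (\<Prod>i<k. [:- real i, 1:])"
  have "degree (\<Prod>i<k. [:- real i, 1:]) \<le> sum (degree \<circ> (\<lambda>i. [:- real i, 1:])) {..<k}"
    by (rule degree_prod_sum_le) simp
  then show "degree ?P \<le> k" by simp
  show "poly ?P x = x gchoose k" for x
    by (simp add: poly_prod gbinomial_prod_rev lessThan_atLeast0)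
qed

text \<open>Discrete integration: by induction the first difference is a combination of binomials,
  and Pascal's rule raises each lower index by one, with \<open>F 0\<close> as the constant of
  integration.\<close>

lemma newton_interpolation:
  assumes "\<And>m. (bdiff ^^ N) F m = 0"
  shows "\<exists>c. \<forall>m. F m = (\<Sum>k<N. c k * (real_of_int m gchoose k))"
  using assms
proof (induction N arbitrary: F)
  case (Suc N)
  have "(bdiff ^^ N) (bdiff F) m = 0" for m
    using Suc.prems[of m] by (simp add: funpow_swap1)
  \<comment> \<open>The argument is shifted because Pascal's rule describes the step from
    \<open>m\<close> to \<open>m + 1\<close>, while \<open>bdiff\<close> looks backwards.\<close>
  moreover have "(bdiff ^^ N) (\<lambda>m. G (m + 1)) m = (bdiff ^^ N) G (m + 1)" for G m
    by (induction N arbitrary: m) (simp_all add: bdiff_def)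
  ultimately obtain c where c: "\<And>m. bdiff F (m + 1) = (\<Sum>k<N. c k * (real_of_int m gchoose k))"
    using Suc.IH[of "\<lambda>m. bdiff F (m + 1)"] by auto
  define G where "G m = F 0 + (\<Sum>k<N. c k * (real_of_int m gchoose Suc k))" for m
  have step: "G (m + 1) - G m = F (m + 1) - F m" for m
    using c[of m] gbinomial_Suc_Suc[of "real_of_int m"]
    by (simp add: G_def bdiff_def sum_subtractf[symmetric] algebra_simps)
  have "F m = G m" for m
  proof (induction m rule: int_induct[where k = 0])
    case base
    show ?case by (simp add: G_def)
  next
    case (step1 i)
    then show ?case using step[of i] by simp
  next
    case (step2 i)
    then show ?case using step[of "i - 1"] by simp
  qed
  moreover have "G m = (\<Sum>k<Suc N. (case k of 0 \<Rightarrow> F 0 | Suc k \<Rightarrow> c k) * (real_of_int m gchoose k))" for m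
    by (simp add: G_def sum.lessThan_Suc_shift del: sum.lessThan_Suc)
  ultimately show ?case by metis
qed simp

text \<open>The alternative \<open>P = 0\<close> is for \<open>N = 0\<close>, where no degree is
  below \<open>N\<close>.\<close>

lemma bdiff_funpow_zero_poly:
  assumes "\<And>m. (bdiff ^^ N) F m = 0"
  shows "\<exists>P. (P = 0 \<or> degree P < N) \<and> (\<forall>m. F m = poly P (real_of_int m))"
proof -
  obtain c where c: "\<And>m. F m = (\<Sum>k<N. c k * (real_of_int m gchoose k))"
    using newton_interpolation[OF assms] by blast
  obtain B :: "nat \<Rightarrow> real poly" where B: "\<And>k. degree (B k) \<le> k" "\<And>k x. poly (B k) x = x gchoose k"
    using gbinomial_poly by metis
  let ?P = "\<Sum>k<N. smult (c k) (B k)"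
  have "degree ?P < N" if "N > 0"
    by (rule degree_sum_less[OF _ that]) (meson B(1) degree_smult_le le_trans lessThan_iff not_less)
  moreover have "?P = 0" if "N = 0" using that by simp
  moreover have "F m = poly ?P (real_of_int m)" for m by (simp add: c poly_sum B)
  ultimately show ?thesis by blast
qed

text \<open>\<open>P\<close> grows like its leading term, so \<open>m powr (q - degree P)\<close>
  has a finite nonzero limit, which only the exponent zero permits.\<close>

lemma poly_growth_degree:
  fixes P :: "real poly"
  assumes lim: "(\<lambda>m. poly P (real m) / real m powr q) \<longlonglongrightarrow> l" and l: "l \<noteq> 0"
  shows "q = real (degree P)"
proof -
  let ?d = "degree P"
  have P0: "P \<noteq> 0" using LIMSEQ_unique[OF lim, of 0] l by auto
  have "((\<lambda>x. poly P x / x ^ ?d) \<longlongrightarrow> lead_coeff P) at_top"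
    using poly_divide_tendsto_aux[of P] by (rule filterlim_mono) (auto simp: at_top_le_at_infinity)
  then have "(\<lambda>m. poly P (real m) / real m ^ ?d) \<longlonglongrightarrow> lead_coeff P"
    by (rule filterlim_compose[OF _ filterlim_real_sequentially])
  from tendsto_divide[OF this lim l]
  have "(\<lambda>m. (poly P (real m) / real m ^ ?d) / (poly P (real m) / real m powr q))
     \<longlonglongrightarrow> lead_coeff P / l" .
  moreover have "\<forall>\<^sub>F m in sequentially. (poly P (real m) / real m ^ ?d) / (poly P (real m) / real m powr q)
      = real m powr (q - ?d)"
  proof -
    have "\<forall>\<^sub>F m in sequentially. poly P (real m) / real m powr q \<noteq> 0"
      using lim l by (rule tendsto_imp_eventually_ne)
    then show ?thesis using eventually_gt_at_top[of 0]
      by eventually_elim (auto simp: powr_diff powr_realpow field_simps)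
  qed
  ultimately have L: "(\<lambda>m. real m powr (q - ?d)) \<longlonglongrightarrow> lead_coeff P / l"
    by (rule Lim_transform_eventually)
  consider "q > ?d" | "q < ?d" | "q = ?d" by linarith
  then show ?thesis
  proof cases
    case 1
    then have "filterlim (\<lambda>m. real m powr (q - ?d)) at_top sequentially" by real_asymp
    then have "filterlim (\<lambda>m. real m powr (q - ?d)) at_infinity sequentially"
      by (rule filterlim_at_top_imp_at_infinity)
    then show ?thesis using not_tendsto_and_filterlim_at_infinity[OF _ L] by simp
  next
    case 2
    then have "(\<lambda>m. real m powr (q - ?d)) \<longlonglongrightarrow> 0" by real_asymp
    from LIMSEQ_unique[OF L this] show ?thesis using P0 l by simp
  qed
qed

text \<open>The sum of \<open>P (- x)\<close> and \<open>P x\<close> has all naturals as roots and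
  so vanishes identically; in even degree its leading coefficient would be twice that of
  \<open>P\<close>.\<close>

lemma poly_odd_degree:
  fixes P :: "real poly"
  assumes odd: "\<And>m::nat. poly P (- real m) = - poly P (real m)" and "P \<noteq> 0"
  shows "odd (degree P)"
proof
  assume "even (degree P)"
  let ?Q = "pcompose P [:0, - 1:] + P"
  have "poly ?Q (real m) = 0" for m using odd[of m] by (simp add: poly_pcompose)
  then have "range real \<subseteq> {x. poly ?Q x = 0}" by blast
  then have "infinite {x. poly ?Q x = 0}"
    by (rule infinite_super) (simp add: range_inj_infinite inj_on_def)
  then have "?Q = 0" using poly_roots_finite by blast
  then have "coeff (pcompose P [:0, - 1:]) (degree P) = - lead_coeff P"
    by (metis add_eq_0_iff2 coeff_minus)
  moreover have "coeff (pcompose P [:0, - 1:]) (degree P) = lead_coeff P"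
    using lead_coeff_comp[of "[:0, - 1:]" P] degree_pcompose[of P "[:0, - 1:]"] \<open>even (degree P)\<close> by simp
  ultimately show False using \<open>P \<noteq> 0\<close> by simp
qed

lemma bdiff_funpow_abs_powr_diff:
  fixes p :: real
  assumes p: "1 \<le> p"
    and zero: "\<And>m. (bdiff ^^ N) (\<lambda>m. \<bar>real_of_int m + 1\<bar> powr p - \<bar>real_of_int m - 1\<bar> powr p) m = 0"
  shows "\<exists>m::int. even m \<and> p = of_int m \<and> m \<le> int N"
proof -
  let ?H = "\<lambda>x::real. \<bar>x + 1\<bar> powr p - \<bar>x - 1\<bar> powr p"
  obtain P where P: "P = 0 \<or> degree P < N" "\<And>m. ?H (real_of_int m) = poly P (real_of_int m)"
    using bdiff_funpow_zero_poly[OF zero] by blast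
  have Pn: "poly P (real m) = ?H (real m)" for m using P(2)[of "int m"] by simp
  have "((\<lambda>x. ((x + 1) powr p - (x - 1) powr p) / x powr (p - 1)) \<longlongrightarrow> 2 * p) at_top"
    using p by real_asymp
  then have "(\<lambda>m. ((real m + 1) powr p - (real m - 1) powr p) / real m powr (p - 1)) \<longlonglongrightarrow> 2 * p"
    by (rule filterlim_compose[OF _ filterlim_real_sequentially])
  moreover have "\<forall>\<^sub>F m in sequentially. ((real m + 1) powr p - (real m - 1) powr p) / real m powr (p - 1)
      = ?H (real m) / real m powr (p - 1)"
    using eventually_ge_at_top[of 1] by eventually_elim simp
  ultimately have "(\<lambda>m. ?H (real m) / real m powr (p - 1)) \<longlonglongrightarrow> 2 * p"
    by (rule Lim_transform_eventually)
  then have lim: "(\<lambda>m. poly P (real m) / real m powr (p - 1)) \<longlonglongrightarrow> 2 * p"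
    by (simp only: Pn)
  from poly_growth_degree[OF lim] p have deg: "p - 1 = real (degree P)" by simp
  \<comment> \<open>The nonzero limit excludes \<open>P = 0\<close>, so \<open>degree P < N\<close>
    holds and gives the bound on \<open>p\<close>.\<close>
  have P0: "P \<noteq> 0" using LIMSEQ_unique[OF lim, of 0] p by auto
  have "poly P (- real m) = - poly P (real m)" for m
    using P(2)[of "- int m"] Pn[of m] abs_minus_commute[of 1 "real m"]
      abs_minus_cancel[of "real m + 1"] by (simp add: add.commute)
  then have "odd (degree P)" using P0 by (rule poly_odd_degree)
  then show ?thesis
    using deg P(1) P0 by (intro exI[of _ "int (degree P) + 1"]) auto
qed

section \<open>Functional calculus and \<open>L\<^sup>p\<close> norms\<close>

text \<open>A unitary that diagonalises \<open>A\<close> also diagonalises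
  \<open>hermitian_fun g A\<close>.\<close>

lemma hermitian_fun_compose:
  assumes "A \<in> carrier_mat n n" "mat_adjoint A = A"
  shows "hermitian_fun f (hermitian_fun g A) = hermitian_fun (\<lambda>t. f (g t)) A"
proof -
  obtain U d where U: "spectral_decomp A U d"
    using hermitian_spectral[OF assms] by blast
  have "dim_row (hermitian_fun g A) = dim_row A"
    unfolding hermitian_fun_eq[OF U] using U by (auto simp: spectral_decomp_def dest: carrier_matD)
  then show ?thesis
    using hermitian_fun_eq[OF spectral_decomp_hermitian_fun[OF U]] hermitian_fun_eq[OF U] by simp
qed

lemma index_adjoint_mult_self:
  fixes Y :: "complex mat"
  assumes "Y \<in> carrier_mat m n" "i < n"
  shows "(mat_adjoint Y * Y) $$ (i, i) = complex_of_real (\<Sum>r<m. (cmod (Y $$ (r, i)))\<^sup>2)"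
  using assms
  by (simp add: scalar_prod_def mat_adjoint_index complex_norm_square[symmetric] lessThan_atLeast0
      mult.commute[of "cnj _"] del: of_real_power)

text \<open>In the eigenbasis \<open>d i\<close> is a diagonal entry of the Gram matrix of
  \<open>Y * U\<close>, hence a sum of squared moduli.\<close>

lemma spectral_decomp_adjoint_mult_self_nonneg:
  fixes Y :: "complex mat"
  assumes Y: "Y \<in> carrier_mat n n" and dec: "spectral_decomp (mat_adjoint Y * Y) U d" and i: "i < n"
  shows "d i \<ge> 0"
proof -
  define D where "D = mat_diag n (\<lambda>i. complex_of_real (d i))"
  have D: "D \<in> carrier_mat n n" by (simp add: D_def)
  have U: "U \<in> carrier_mat n n" and U1: "mat_adjoint U * U = 1\<^sub>m n"
    and A: "mat_adjoint Y * Y = U * D * mat_adjoint U"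
    using dec Y by (auto simp: spectral_decomp_def D_def)
  note as = assoc_mult_mat[of _ n n _ n _ n] mult_carrier_mat[of _ n n _ n]
  have aU: "mat_adjoint U \<in> carrier_mat n n" and aY: "mat_adjoint Y \<in> carrier_mat n n" using U Y by auto
  have "mat_adjoint (Y * U) * (Y * U) = mat_adjoint U * (mat_adjoint Y * Y) * U"
    unfolding mat_adjoint_mult[OF Y U] using Y U aU aY by (simp add: as)
  also have "\<dots> = (mat_adjoint U * U) * D * (mat_adjoint U * U)"
    unfolding A using U aU D by (simp add: as)
  also have "\<dots> = D" unfolding U1 using D by simp
  finally have "D $$ (i, i) = complex_of_real (\<Sum>r<n. (cmod ((Y * U) $$ (r, i)))\<^sup>2)"
    using index_adjoint_mult_self[OF mult_carrier_mat[OF Y U] i] by simp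
  moreover have "D $$ (i, i) = complex_of_real (d i)" using i by (simp add: D_def mat_diag_def)
  ultimately have "d i = (\<Sum>r<n. (cmod ((Y * U) $$ (r, i)))\<^sup>2)" by (metis of_real_eq_iff)
  then show ?thesis by (simp add: sum_nonneg)
qed

lemma adjoint_mult_self_hermitian:
  fixes Y :: "complex mat"
  assumes "Y \<in> carrier_mat n n"
  shows "mat_adjoint Y * Y \<in> carrier_mat n n" "mat_adjoint (mat_adjoint Y * Y) = mat_adjoint Y * Y"
proof -
  have aY: "mat_adjoint Y \<in> carrier_mat n n" using assms by simp
  show "mat_adjoint Y * Y \<in> carrier_mat n n" by (rule mult_carrier_mat[OF aY assms])
  show "mat_adjoint (mat_adjoint Y * Y) = mat_adjoint Y * Y"
    using mat_adjoint_mult[OF aY assms] by simp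
qed

text \<open>The spectrum of \<open>mat_adjoint Y * Y\<close> is nonnegative. This allows exchanging
  functions that need not agree on negative arguments.\<close>

lemma hermitian_fun_adjoint_mult_self_cong:
  fixes Y :: "complex mat"
  assumes Y: "Y \<in> carrier_mat n n" and eq: "\<And>t. t \<ge> 0 \<Longrightarrow> f t = g t"
  shows "hermitian_fun f (mat_adjoint Y * Y) = hermitian_fun g (mat_adjoint Y * Y)"
proof -
  note H = adjoint_mult_self_hermitian[OF Y]
  obtain U d where U: "spectral_decomp (mat_adjoint Y * Y) U d"
    using hermitian_spectral[OF H] by blast
  have "mat_diag n (\<lambda>i. complex_of_real (f (d i))) = mat_diag n (\<lambda>i. complex_of_real (g (d i)))"
    by (rule eq_matI)
      (use spectral_decomp_adjoint_mult_self_nonneg[OF Y U] eq in \<open>auto simp: mat_diag_def\<close>)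
  then show ?thesis unfolding hermitian_fun_eq[OF U] using Y by simp
qed

text \<open>In the coordinates \<open>w\<close> of the eigenbasis, \<open>w $ i\<close> can be
  nonzero only where \<open>d i = t\<close>. This evaluates the functional calculus on known
  eigenvectors without building a unitary from them.\<close>

lemma hermitian_fun_eigenvector:
  assumes A: "A \<in> carrier_mat n n" "mat_adjoint A = A" and v: "v \<in> carrier_vec n"
    and ev: "A *\<^sub>v v = complex_of_real t \<cdot>\<^sub>v v"
  shows "hermitian_fun f A *\<^sub>v v = complex_of_real (f t) \<cdot>\<^sub>v v"
proof -
  obtain U d where dec: "spectral_decomp A U d"
    using hermitian_spectral[OF A] by blast
  define D where "D g = mat_diag n (\<lambda>i. complex_of_real (g (d i)))" for g
  have D: "D g \<in> carrier_mat n n" for g by (simp add: D_def)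
  have U: "U \<in> carrier_mat n n" and U1: "mat_adjoint U * U = 1\<^sub>m n"
    and AU: "A = U * D (\<lambda>t. t) * mat_adjoint U"
    using dec A by (auto simp: spectral_decomp_def D_def)
  have aU: "mat_adjoint U \<in> carrier_mat n n" using U by simp
  define w where "w = mat_adjoint U *\<^sub>v v"
  have w: "w \<in> carrier_vec n" using aU v by (simp add: w_def)
  have apply_w: "(U * D g * mat_adjoint U) *\<^sub>v v = U *\<^sub>v (D g *\<^sub>v w)" for g
    unfolding w_def using U aU D[of g] v
    by (simp add: assoc_mult_mat_vec[of _ n n _ n] mult_carrier_mat[of _ n n _ n]
        mult_mat_vec_carrier[of _ n n])
  have inv_apply: "mat_adjoint U *\<^sub>v (U *\<^sub>v y) = y" if "y \<in> carrier_vec n" for y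
    using assoc_mult_mat_vec[OF aU U that] U1 that by simp
  have UU: "U *\<^sub>v w = v"
    unfolding w_def using assoc_mult_mat_vec[OF U aU v] unitary_right[OF U U1] v by simp
  have D_index: "(D g *\<^sub>v w) $ i = complex_of_real (g (d i)) * w $ i" if "i < n" for g i
  proof -
    have "(D g *\<^sub>v w) $ i = (\<Sum>j<n. D g $$ (i, j) * w $ j)"
      using that D[of g] w by (auto simp: scalar_prod_def lessThan_atLeast0)
    also have "\<dots> = (\<Sum>j<n. if j = i then complex_of_real (g (d i)) * w $ i else 0)"
      using that by (intro sum.cong refl) (auto simp: D_def mat_diag_def)
    finally show ?thesis using that by simp
  qed
  have "D (\<lambda>t. t) *\<^sub>v w = mat_adjoint U *\<^sub>v (complex_of_real t \<cdot>\<^sub>v v)"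
    using inv_apply[OF mult_mat_vec_carrier[OF D w]] apply_w[of "\<lambda>t. t"] ev AU by metis
  also have "\<dots> = complex_of_real t \<cdot>\<^sub>v w"
    unfolding w_def by (rule mult_mat_vec[OF aU v])
  finally have Dw: "D (\<lambda>t. t) *\<^sub>v w = complex_of_real t \<cdot>\<^sub>v w" .
  have "D f *\<^sub>v w = complex_of_real (f t) \<cdot>\<^sub>v w"
  proof (rule eq_vecI)
    fix i assume "i < dim_vec (complex_of_real (f t) \<cdot>\<^sub>v w)"
    then have i: "i < n" using w by simp
    have "w $ i = 0 \<or> d i = t"
      using D_index[OF i, of "\<lambda>t. t"] Dw i w by auto
    then show "(D f *\<^sub>v w) $ i = (complex_of_real (f t) \<cdot>\<^sub>v w) $ i"
      using D_index[OF i, of f] i w by auto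
  qed (use D[of f] w in auto)
  then have "U *\<^sub>v (D f *\<^sub>v w) = complex_of_real (f t) \<cdot>\<^sub>v v"
    using mult_mat_vec[OF U w] UU by simp
  moreover have "hermitian_fun f A = U * D f * mat_adjoint U"
    unfolding hermitian_fun_eq[OF dec] D_def using A by simp
  ultimately show ?thesis using apply_w by simp
qed

lemma hermitian_fun_power:
  assumes A: "A \<in> carrier_mat n n" "mat_adjoint A = A"
  shows "hermitian_fun (\<lambda>t. t ^ m) A = A ^\<^sub>m m"
proof -
  obtain U d where dec: "spectral_decomp A U d"
    using hermitian_spectral[OF A] by blast
  define D where "D k = mat_diag n (\<lambda>i. complex_of_real (d i ^ k))" for k :: nat
  have D: "D k \<in> carrier_mat n n" for k by (simp add: D_def)
  have U: "U \<in> carrier_mat n n" and U1: "mat_adjoint U * U = 1\<^sub>m n"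
    and AU: "A = U * D 1 * mat_adjoint U"
    using dec A by (auto simp: spectral_decomp_def D_def)
  have aU: "mat_adjoint U \<in> carrier_mat n n" using U by simp
  have "U * D m * mat_adjoint U = A ^\<^sub>m m"
  proof (induction m)
    case 0
    have "D 0 = 1\<^sub>m n" by (rule eq_matI) (auto simp: D_def mat_diag_def)
    then show ?case using U unitary_right[OF U U1] A by simp
  next
    case (Suc m)
    have DS: "D (Suc m) = D m * D 1"
      unfolding D_def mat_diag_diag by (simp add: mult.commute)
    have "A ^\<^sub>m Suc m = U * D m * (mat_adjoint U * U) * (D 1 * mat_adjoint U)"
      unfolding pow_mat.simps Suc[symmetric] unfolding AU using U aU D[of m] D[of 1]
      by (simp add: assoc_mult_mat[of _ n n _ n _ n] mult_carrier_mat[of _ n n _ n])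
    also have "\<dots> = U * D (Suc m) * mat_adjoint U"
      unfolding U1 DS using U aU D[of m] D[of 1]
      by (simp add: assoc_mult_mat[of _ n n _ n _ n] mult_carrier_mat[of _ n n _ n])
    finally show ?case by simp
  qed
  then show ?thesis unfolding hermitian_fun_eq[OF dec] D_def using A by simp
qed

section \<open>Norms as traces of functions of \<open>mat_adjoint Y * Y\<close>\<close>

lemma block_mat_carrier [simp]: "block_mat N k x \<in> carrier_mat (k * 2 ^ N) (k * 2 ^ N)"
  by (simp add: block_mat_def)

lemma Lp_norm_adjoint_mult_self:
  "Lp_norm p N k x = (Re (tr_Tr N k (hermitian_fun (\<lambda>t. t powr (p / 2))
     (mat_adjoint (block_mat N k x) * block_mat N k x)))) powr (1 / p)"
proof -
  note Y = block_mat_carrier[of N k x]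
  have "hermitian_fun (\<lambda>t. sqrt t powr p) (mat_adjoint (block_mat N k x) * block_mat N k x)
      = hermitian_fun (\<lambda>t. t powr (p / 2)) (mat_adjoint (block_mat N k x) * block_mat N k x)"
    by (rule hermitian_fun_adjoint_mult_self_cong[OF Y]) (simp add: powr_half_sqrt[symmetric] powr_powr)
  then show ?thesis
    unfolding Lp_norm_def mat_abs_def hermitian_fun_compose[OF adjoint_mult_self_hermitian[OF Y]] by simp
qed

lemma Lp_norm_even:
  assumes "m \<ge> 1"
  shows "Lp_norm (2 * real m) N k x
     = (Re (tr_Tr N k ((mat_adjoint (block_mat N k x) * block_mat N k x) ^\<^sub>m m))) powr (1 / (2 * real m))"
proof -
  note Y = block_mat_carrier[of N k x]
  \<comment> \<open>At \<open>t = 0\<close> this needs \<open>m \<ge> 1\<close>: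
    \<open>0 powr 0\<close> is 0, but \<open>0 ^ 0\<close> is 1.\<close>
  have "hermitian_fun (\<lambda>t. t powr (2 * real m / 2)) (mat_adjoint (block_mat N k x) * block_mat N k x)
      = hermitian_fun (\<lambda>t. t ^ m) (mat_adjoint (block_mat N k x) * block_mat N k x)"
    by (rule hermitian_fun_adjoint_mult_self_cong[OF Y]) (use assms in \<open>auto simp: powr_realpow'\<close>)
  then show ?thesis
    unfolding Lp_norm_adjoint_mult_self hermitian_fun_power[OF adjoint_mult_self_hermitian[OF Y]] by simp
qed

text \<open>The vacuum is the basis vector with index 0, so each diagonal block contributes its top
  left entry.\<close>

lemma tr_Tr_index: "tr_Tr N k Y = (\<Sum>i<k. Y $$ (i * 2 ^ N, i * 2 ^ N))"
proof -
  have "Tr N (block N Y i i) = Y $$ (i * 2 ^ N, i * 2 ^ N)" for i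
  proof -
    have "Tr N (block N Y i i) = (block N Y i i *\<^sub>v unit_vec (2 ^ N) 0) $ 0"
      by (simp add: Tr_def vacuum_unit inner_sum[of _ "2 ^ N"] block_def unit_vec_index
          if_distrib[of cnj] if_distrib[of "\<lambda>z. _ * z"] cong: if_cong)
    also have "\<dots> = col (block N Y i i) 0 $ 0"
      by (subst mult_unit_vec[of _ "2 ^ N"]) (auto simp: block_def)
    finally show ?thesis by (simp add: block_def)
  qed
  then show ?thesis by (simp add: tr_Tr_def)
qed

section \<open>Even exponents\<close>

definition flip :: "nat \<Rightarrow> nat \<Rightarrow> nat" where
  "flip j A = set_encode (sym_diff (set_decode A) {j})"

lemma set_decode_flip [simp]: "set_decode (flip j A) = sym_diff (set_decode A) {j}"
  by (simp add: flip_def)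

lemma flip_flip [simp]: "flip j (flip j A) = A"
  by (rule set_decode_inj) auto

lemma flip_less: "j < N \<Longrightarrow> A < 2 ^ N \<Longrightarrow> flip j A < 2 ^ N"
  using set_decode_less[of A N] by (auto simp: power_less_iff_decode[symmetric])

lemma flip_commute: "flip i (flip j A) = flip j (flip i A)"
  by (rule set_decode_inj) auto

lemma pos_flip_le: "j \<le> i \<Longrightarrow> pos j (flip i A) = pos j A"
  unfolding pos_def by (rule arg_cong[of _ _ card]) auto

text \<open>Toggling a mode below \<open>j\<close> changes the number of occupied modes below
  \<open>j\<close> by one. This is the source of anticommutation.\<close>

lemma pos_flip_less:
  assumes "i < j"
  shows "(- 1 :: 'a :: ring_1) ^ pos j (flip i A) = - ((- 1) ^ pos j A)"
proof (cases "i \<in> set_decode A")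
  case True
  then have "{l \<in> set_decode A. l < j} = insert i {l \<in> set_decode (flip i A). l < j}"
    using assms by auto
  then have "pos j A = Suc (pos j (flip i A))"
    unfolding pos_def using True by simp
  then show ?thesis by simp
next
  case False
  then have "{l \<in> set_decode (flip i A). l < j} = insert i {l \<in> set_decode A. l < j}"
    using assms by auto
  then have "pos j (flip i A) = Suc (pos j A)"
    unfolding pos_def using False by simp
  then show ?thesis by simp
qed

text \<open>Creation fills the rows \<open>A\<close> in which \<open>j\<close> is occupied, its
  adjoint the other rows; for \<open>j < N\<close> the sum is a signed permutation matrix.\<close>

lemma fermion_index:
  assumes "A < 2 ^ N" "B < 2 ^ N"
  shows "fermion N j $$ (A, B) = (if B = flip j A then (- 1) ^ pos j A else 0)"
proof -
  have del: "B = A - 2 ^ j \<longleftrightarrow> B = flip j A" if "j \<in> set_decode A" for A B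
  proof -
    have "set_decode (A - 2 ^ j) = set_decode (flip j A)"
      using that by (simp add: set_decode_diff)
    then have "A - 2 ^ j = flip j A" by (rule set_decode_inj)
    then show ?thesis by simp
  qed
  have c: "creation N j $$ (A, B) = (if j \<in> set_decode A \<and> B = flip j A then (- 1) ^ pos j A else 0)"
    if "A < 2 ^ N" "B < 2 ^ N" for A B
    unfolding creation_index[OF that] using del[of A B] by (cases "j \<in> set_decode A") simp_all
  have "fermion N j $$ (A, B) = creation N j $$ (A, B) + cnj (creation N j $$ (B, A))"
    using assms by (simp add: fermion_def mat_adjoint_index)
  also have "\<dots> = (if j \<in> set_decode A \<and> B = flip j A then (- 1) ^ pos j A else 0)
     + (if j \<in> set_decode B \<and> A = flip j B then (- 1) ^ pos j B else 0)"
    unfolding c[OF assms] c[OF assms(2,1)] by simp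
  finally have "fermion N j $$ (A, B) = (if j \<in> set_decode A \<and> B = flip j A then (- 1) ^ pos j A else 0)
     + (if j \<in> set_decode B \<and> A = flip j B then (- 1) ^ pos j B else 0)" .
  moreover have "A = flip j B \<longleftrightarrow> B = flip j A" by auto
  ultimately show ?thesis by (auto simp: pos_flip_le)
qed

lemma mat_adjoint_fermion [simp]: "mat_adjoint (fermion N j) = fermion N j"
  by (rule eq_matI) (auto simp: mat_adjoint_index fermion_index pos_flip_le)

definition fermion_word :: "nat \<Rightarrow> nat list \<Rightarrow> complex mat" where
  "fermion_word N js = foldr (*) (map (fermion N) js) (1\<^sub>m (2 ^ N))"

lemma fermion_prod_eq_word: "fermion_prod n = fermion_word (2 * n) [0..<2 * n]"
  by (simp add: fermion_prod_def fermion_word_def)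

lemma fermion_word_carrier [simp]: "fermion_word N js \<in> carrier_mat (2 ^ N) (2 ^ N)"
  unfolding fermion_word_def by (induction js) (auto intro: mult_carrier_mat[of _ _ "2 ^ N"])

lemma fermion_word_Nil: "fermion_word N [] = 1\<^sub>m (2 ^ N)"
  and fermion_word_Cons: "fermion_word N (j # js) = fermion N j * fermion_word N js"
  by (simp_all add: fermion_word_def)

lemma fermion_mult_index:
  assumes M: "M \<in> carrier_mat (2 ^ N) l" and "j < N" "A < 2 ^ N" "B < l"
  shows "(fermion N j * M) $$ (A, B) = (- 1) ^ pos j A * M $$ (flip j A, B)"
proof -
  have "(fermion N j * M) $$ (A, B) = (\<Sum>C<2 ^ N. fermion N j $$ (A, C) * M $$ (C, B))"
    using assms by (auto simp: scalar_prod_def lessThan_atLeast0)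
  also have "\<dots> = (\<Sum>C<2 ^ N. if C = flip j A then (- 1) ^ pos j A * M $$ (flip j A, B) else 0)"
    using assms by (intro sum.cong refl) (auto simp: fermion_index)
  finally show ?thesis using assms flip_less[of j N A] by simp
qed

text \<open>Each letter toggles its mode once, and distinctness keeps the toggles from
  cancelling.\<close>

lemma fermion_word_support:
  assumes "distinct js" "set js \<subseteq> {..<N}" "A < 2 ^ N" "B < 2 ^ N" "fermion_word N js $$ (A, B) \<noteq> 0"
  shows "sym_diff (set_decode A) (set_decode B) = set js"
  using assms
proof (induction js arbitrary: A)
  case Nil
  then show ?case by (auto simp: fermion_word_Nil split: if_splits)
next
  case (Cons j js)
  then have "fermion_word N js $$ (flip j A, B) \<noteq> 0"
    by (auto simp: fermion_word_Cons fermion_mult_index[OF fermion_word_carrier])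
  then have "sym_diff (set_decode (flip j A)) (set_decode B) = set js"
    using Cons.IH[of "flip j A"] Cons.prems flip_less[of j N A] by simp
  then have "sym_diff (sym_diff (set_decode A) {j}) (set_decode B) = set js" by simp
  moreover have "j \<notin> set js" using Cons.prems(1) by simp
  ultimately have "sym_diff (set_decode A) (set_decode B) = insert j (set js)" by blast
  then show ?case by simp
qed

section \<open>Sign bookkeeping by distances between Fock indices\<close>

text \<open>Reduction modulo \<open>2 ^ N\<close> strips the block number from a row or column of a
  block matrix and leaves the Fock index.\<close>

definition flips :: "nat \<Rightarrow> nat \<Rightarrow> nat \<Rightarrow> nat set" where
  "flips N r s = sym_diff (set_decode (r mod 2 ^ N)) (set_decode (s mod 2 ^ N))"

lemma flips_subset: "flips N r s \<subseteq> {..<N}"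
  unfolding flips_def using set_decode_less[of "r mod 2 ^ N" N] set_decode_less[of "s mod 2 ^ N" N] by auto

lemma finite_flips [simp]: "finite (flips N r s)"
  using flips_subset by (rule finite_subset) simp

lemma flips_commute: "flips N r s = flips N s r"
  by (auto simp: flips_def)

lemma flips_self [simp]: "flips N r r = {}"
  by (simp add: flips_def)

lemma card_flips_triangle: "card (flips N r s) \<le> card (flips N r t) + card (flips N t s)"
proof -
  have "flips N r s \<subseteq> flips N r t \<union> flips N t s" by (auto simp: flips_def)
  then have "card (flips N r s) \<le> card (flips N r t \<union> flips N t s)"
    by (intro card_mono) auto
  also have "\<dots> \<le> card (flips N r t) + card (flips N t s)" by (rule card_Un_le)
  finally show ?thesis .
qed

text \<open>Each mode lies in none or in exactly two of the three symmetric differences.\<close>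

lemma card_flips_perimeter: "card (flips N r s) + card (flips N r t) + card (flips N t s) \<le> 2 * N"
proof -
  let ?S = "flips N r t" and ?T = "flips N t s"
  have R: "flips N r s = (?S \<union> ?T) - (?S \<inter> ?T)" by (auto simp: flips_def)
  have "card (flips N r s) = card (?S \<union> ?T) - card (?S \<inter> ?T)"
    unfolding R by (rule card_Diff_subset) auto
  moreover have "card ?S + card ?T = card (?S \<union> ?T) + card (?S \<inter> ?T)"
    by (rule card_Un_Int) auto
  moreover have "card (?S \<union> ?T) \<le> card {..<N}"
    using flips_subset[of N r t] flips_subset[of N t s] by (intro card_mono) auto
  moreover have "card (?S \<inter> ?T) \<le> card (?S \<union> ?T)" by (intro card_mono) auto
  ultimately show ?thesis unfolding card_lessThan by linarith
qed

text \<open>Think of \<open>P\<close> and \<open>Q\<close> as products of \<open>a\<close> elements of \<open>M\<^sub>k \<otimes> F\<^sub>n\<close>, where \<open>N = 2n\<close>, and of their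
  images under \<open>\<tau>\<close>.  Words with an even number of factors \<open>\<omega>\<^sub>1\<cdots>\<omega>\<^sub>N\<close> flip at most \<open>a\<close> occupation
  numbers and contribute to \<open>P + Q\<close>; words with an odd number of them flip at least \<open>N + 1 - a\<close> and
  contribute to \<open>P - Q\<close>.\<close>

definition twin :: "nat \<Rightarrow> nat \<Rightarrow> nat \<Rightarrow> complex mat \<Rightarrow> complex mat \<Rightarrow> bool" where
  "twin N m a P Q \<longleftrightarrow> P \<in> carrier_mat m m \<and> Q \<in> carrier_mat m m \<and>
     (\<forall>r<m. \<forall>s<m. (a < card (flips N r s) \<longrightarrow> P $$ (r, s) = - Q $$ (r, s)) \<and>
        (card (flips N r s) + a \<le> N \<longrightarrow> P $$ (r, s) = Q $$ (r, s)))"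

lemma twin_one: "m = k * 2 ^ N \<Longrightarrow> twin N m 0 (1\<^sub>m m) (1\<^sub>m m)"
  by (auto simp: twin_def)

lemma twin_adjoint: "twin N m a P Q \<Longrightarrow> twin N m a (mat_adjoint P) (mat_adjoint Q)"
  unfolding twin_def by (auto simp: mat_adjoint_index flips_commute)

text \<open>Entries are compared summand by summand. The distances between \<open>r\<close>,
  \<open>t\<close> and \<open>s\<close> determine enough of the signs of the two factors, and a
  factor that is both preserved and negated is zero.\<close>

lemma twin_mult:
  assumes 1: "twin N m a P Q" and 2: "twin N m b P' Q'"
  shows "twin N m (a + b) (P * P') (Q * Q')"
proof -
  have c: "P \<in> carrier_mat m m" "Q \<in> carrier_mat m m" "P' \<in> carrier_mat m m" "Q' \<in> carrier_mat m m"
    using 1 2 by (auto simp: twin_def)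
  have ix: "(P * P') $$ (r, s) = (\<Sum>t<m. P $$ (r, t) * P' $$ (t, s))"
    "(Q * Q') $$ (r, s) = (\<Sum>t<m. Q $$ (r, t) * Q' $$ (t, s))" if "r < m" "s < m" for r s
    using c that by (auto simp: scalar_prod_def lessThan_atLeast0)
  have P: "a < card (flips N r t) \<Longrightarrow> P $$ (r, t) = - Q $$ (r, t)"
    "card (flips N r t) + a \<le> N \<Longrightarrow> P $$ (r, t) = Q $$ (r, t)" if "r < m" "t < m" for r t
    using 1 that by (auto simp: twin_def)
  have P': "b < card (flips N t s) \<Longrightarrow> P' $$ (t, s) = - Q' $$ (t, s)"
    "card (flips N t s) + b \<le> N \<Longrightarrow> P' $$ (t, s) = Q' $$ (t, s)" if "t < m" "s < m" for t s
    using 2 that by (auto simp: twin_def)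
  have zero: "y = - y \<Longrightarrow> y = 0" for y :: complex by simp
  have "(P * P') $$ (r, s) = - (Q * Q') $$ (r, s)"
    if rs: "r < m" "s < m" and far: "a + b < card (flips N r s)" for r s
    unfolding ix[OF rs] sum_negf[symmetric]
  proof (rule sum.cong[OF refl])
    fix t assume t: "t \<in> {..<m}"
    note P = P[OF rs(1), of t] and P' = P'[OF _ rs(2), of t]
    \<comment> \<open>The triangle inequality gives a negated factor, the perimeter bound a
      preserved one. If they are the same factor, the summand is zero.\<close>
    have "a < card (flips N r t) \<or> b < card (flips N t s)"
      using card_flips_triangle[of N r s t] far by linarith
    moreover have "card (flips N r t) + a \<le> N \<or> card (flips N t s) + b \<le> N"
      using card_flips_perimeter[of N r s t] far by linarith
    ultimately show "P $$ (r, t) * P' $$ (t, s) = - (Q $$ (r, t) * Q' $$ (t, s))"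
      using P P' t zero[of "Q $$ (r, t)"] zero[of "Q' $$ (t, s)"] by auto
  qed
  moreover have "(P * P') $$ (r, s) = (Q * Q') $$ (r, s)"
    if rs: "r < m" "s < m" and near: "card (flips N r s) + (a + b) \<le> N" for r s
    unfolding ix[OF rs]
  proof (rule sum.cong[OF refl])
    fix t assume t: "t \<in> {..<m}"
    note P = P[OF rs(1), of t] and P' = P'[OF _ rs(2), of t]
    \<comment> \<open>If one factor is too far from the diagonal to be preserved, the triangle
      inequality pushes the other one far enough to be negated.\<close>
    have "card (flips N r t) + a \<le> N \<or> b < card (flips N t s)"
      using card_flips_triangle[of N r t s] near by (auto simp: flips_commute[of N s t])
    moreover have "a < card (flips N r t) \<or> card (flips N t s) + b \<le> N"
      using card_flips_triangle[of N t s r] near by (auto simp: flips_commute[of N t r])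
    ultimately show "P $$ (r, t) * P' $$ (t, s) = Q $$ (r, t) * Q' $$ (t, s)"
      using P P' t zero[of "Q $$ (r, t)"] zero[of "Q' $$ (t, s)"] by auto
  qed
  ultimately show ?thesis
    unfolding twin_def using mult_carrier_mat[OF c(1,3)] mult_carrier_mat[OF c(2,4)] by blast
qed

lemma twin_power:
  assumes "twin N m a P Q" "m = k * 2 ^ N"
  shows "twin N m (l * a) (P ^\<^sub>m l) (Q ^\<^sub>m l)"
proof (induction l)
  case 0
  then show ?case using assms twin_one[of m k N] by (auto simp: twin_def)
next
  case (Suc l)
  then show ?case using twin_mult[OF Suc assms(1)] by (simp add: add.commute)
qed

text \<open>Diagonal entries are at distance zero, so \<open>a \<le> N\<close> puts them among the
  preserved ones.\<close>

lemma twin_tr_Tr: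
  assumes "twin N (k * 2 ^ N) a P Q" "a \<le> N"
  shows "tr_Tr N k P = tr_Tr N k Q"
  unfolding tr_Tr_index by (rule sum.cong) (use assms in \<open>auto simp: twin_def\<close>)

text \<open>The unit and the single Fermions toggle at most one mode, the full product all
  \<open>2 * n\<close>. Entries at distance above one see only the product, whose coefficient
  changes sign; entries at distance below \<open>2 * n\<close> do not see it.\<close>

lemma twin_block_mat_tau:
  assumes n: "n \<ge> 1" and x: "x \<in> mats_over k (F_space n)"
  shows "twin (2 * n) (k * 2 ^ (2 * n)) 1
    (block_mat (2 * n) k x) (block_mat (2 * n) k (amplify (tau n) x))"
proof -
  let ?N = "2 * n" let ?K = "2 ^ (2 * n) :: nat"
  have "\<exists>y. i < k \<longrightarrow> j < k \<longrightarrow> x i j = F_comb n (fst y) (fst (snd y)) (snd (snd y))" for i j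
    using x unfolding mats_over_def F_space_def by fastforce
  then obtain y where y: "\<And>i j. i < k \<Longrightarrow> j < k \<Longrightarrow>
      x i j = F_comb n (fst (y i j)) (fst (snd (y i j))) (snd (snd (y i j)))"
    by metis
  have entry: "(card (flips ?N r s) > 1 \<longrightarrow> block_mat ?N k x $$ (r, s)
        = - block_mat ?N k (amplify (tau n) x) $$ (r, s)) \<and>
      (card (flips ?N r s) + 1 \<le> ?N \<longrightarrow> block_mat ?N k x $$ (r, s)
        = block_mat ?N k (amplify (tau n) x) $$ (r, s))"
    if rs: "r < k * ?K" "s < k * ?K" for r s
  proof -
    let ?A = "r mod ?K" and ?B = "s mod ?K"
    have AB: "?A < ?K" "?B < ?K" by simp_all
    have d: "r div ?K < k" "s div ?K < k" using rs by (simp_all add: less_mult_imp_div_less)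
    define a b c where "a = fst (y (r div ?K) (s div ?K))" and "b = fst (snd (y (r div ?K) (s div ?K)))"
      and "c = snd (snd (y (r div ?K) (s div ?K)))"
    have "x (r div ?K) (s div ?K) = F_comb n a b c" using y[OF d] by (simp add: a_def b_def c_def)
    then have X: "block_mat ?N k x $$ (r, s) = F_comb n a b c $$ (?A, ?B)"
      and Y: "block_mat ?N k (amplify (tau n) x) $$ (r, s) = F_comb n a b (- c) $$ (?A, ?B)"
      using rs by (simp_all add: block_mat_def amplify_def tau_F_comb[OF n])
    have "fermion ?N j $$ (?A, ?B) = 0" if "card (flips ?N r s) > 1" for j
    proof -
      have "flips ?N r s = {j}" if "?B = flip j ?A"
        using that set_decode_flip[of j ?A] by (auto simp: flips_def)
      then have "?B \<noteq> flip j ?A" using \<open>card (flips ?N r s) > 1\<close> by fastforce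
      then show ?thesis by (simp add: fermion_index)
    qed
    moreover have "?A \<noteq> ?B" if "card (flips ?N r s) > 1"
      using that by (auto simp: flips_def)
    moreover have "fermion_prod n $$ (?A, ?B) = 0" if "card (flips ?N r s) + 1 \<le> ?N"
    proof (rule ccontr)
      assume "fermion_prod n $$ (?A, ?B) \<noteq> 0"
      then have "flips ?N r s = {0..<?N}"
        using fermion_word_support[of "[0..<?N]" ?N ?A ?B]
        by (simp add: fermion_prod_eq_word flips_def lessThan_atLeast0)
      then show False using that by simp
    qed
    ultimately show ?thesis
      unfolding X Y F_comb_index[OF AB] by auto
  qed
  then show ?thesis unfolding twin_def by simp
qed

theorem complete_isometry_tau_even:
  assumes n: "n \<ge> 1" and m: "m \<ge> 1" "m \<le> n"
  shows "complete_isometry (2 * real m) (2 * n) (F_space n) (tau n)"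
  unfolding complete_isometry_def
proof (intro allI impI ballI)
  fix k x assume x: "x \<in> mats_over k (F_space n)"
  note t = twin_block_mat_tau[OF n x]
  \<comment> \<open>\<open>mat_adjoint Y * Y\<close> counts as two factors and its power as
    \<open>m * (1 + 1)\<close>, which is at most \<open>2 * n\<close>.\<close>
  from twin_tr_Tr[OF twin_power[OF twin_mult[OF twin_adjoint[OF t] t] refl, of m]] m
  show "Lp_norm (2 * real m) (2 * n) k (amplify (tau n) x) = Lp_norm (2 * real m) (2 * n) k x"
    by (simp add: Lp_norm_even[OF m(1)])
qed

lemma cb_norm_le_1_iff:
  "cb_norm p N X u \<le> 1 \<longleftrightarrow>
     (\<forall>k\<ge>1. \<forall>x\<in>mats_over k X. Lp_norm p N k x \<le> 1 \<longrightarrow> Lp_norm p N k (amplify u x) \<le> 1)"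
  unfolding cb_norm_def amp_norm_def by (auto simp: SUP_le_iff)

lemma complete_isometry_imp_cb_norm_le_1:
  "complete_isometry p N X u \<Longrightarrow> cb_norm p N X u \<le> 1"
  by (simp add: cb_norm_le_1_iff complete_isometry_def)

section \<open>Rademacher variables from Fermions\<close>

text \<open>The operator \<open>\<omega>\<^sub>j \<otimes> \<omega>\<^sub>j\<close>, acting on functions of the two Fock space indices.\<close>

definition twist :: "nat \<Rightarrow> (nat \<Rightarrow> nat \<Rightarrow> complex) \<Rightarrow> nat \<Rightarrow> nat \<Rightarrow> complex" where
  "twist j \<psi> A B = (- 1) ^ pos j A * (- 1) ^ pos j B * \<psi> (flip j A) (flip j B)"

lemma minus_one_power_square [simp]: "(- 1 :: complex) ^ k * ((- 1) ^ k * x) = x"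
  by (simp flip: mult.assoc power_add)

lemma twist_twist [simp]: "twist j (twist j \<psi>) = \<psi>"
  by (intro ext) (simp add: twist_def pos_flip_le mult_ac)

text \<open>Distinct Fermions anticommute in each tensor factor, and the two sign changes
  cancel.\<close>

lemma twist_commute: "twist i (twist j \<psi>) = twist j (twist i \<psi>)"
proof -
  have "twist i (twist j \<psi>) = twist j (twist i \<psi>)" if "i < j" for i j
    using that by (intro ext) (simp add: twist_def pos_flip_le pos_flip_less flip_commute[of i j] mult_ac)
  then show ?thesis by (cases i j rule: linorder_cases) auto
qed

lemma twist_linear: "twist j (\<lambda>A B. c * \<psi> A B + d * \<phi> A B) = (\<lambda>A B. c * twist j \<psi> A B + d * twist j \<phi> A B)"
  by (intro ext) (simp add: twist_def algebra_simps)

section \<open>Joint eigenfunctions of the twists\<close>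

definition sg :: "nat set \<Rightarrow> nat \<Rightarrow> real" where
  "sg E j = (if j \<in> E then - 1 else 1)"

lemma sg_square [simp]: "sg E j * sg E j = 1"
  by (simp add: sg_def)

text \<open>Applies the factors \<open>(1 + sg E j * twist j) / 2\<close> for \<open>j < N\<close>,
  the spectral projections of the commuting involutions \<open>twist j\<close>.\<close>

primrec eproj :: "nat set \<Rightarrow> nat \<Rightarrow> (nat \<Rightarrow> nat \<Rightarrow> complex) \<Rightarrow> nat \<Rightarrow> nat \<Rightarrow> complex" where
  "eproj E 0 \<psi> = \<psi>"
| "eproj E (Suc j) \<psi> =
     (\<lambda>A B. 1 / 2 * eproj E j \<psi> A B + complex_of_real (sg E j) / 2 * twist j (eproj E j \<psi>) A B)"

text \<open>As \<open>twist j\<close> is an involution, the factor with index \<open>j\<close>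
  absorbs it and leaves the sign; the other factors commute with it.\<close>

lemma twist_eproj:
  "j < N \<Longrightarrow> twist j (eproj E N \<psi>) = (\<lambda>A B. complex_of_real (sg E j) * eproj E N \<psi> A B)"
proof (induction N)
  case (Suc N)
  have sq: "complex_of_real (sg E N) * (complex_of_real (sg E N) * x) = x" for x
    by (simp flip: mult.assoc of_real_mult)
  show ?case
  proof (cases "j = N")
    case True
    show ?thesis unfolding True eproj.simps twist_linear twist_twist
      by (simp add: algebra_simps sq)
  next
    case False
    then have IH: "twist j (eproj E N \<psi>) = (\<lambda>A B. complex_of_real (sg E j) * eproj E N \<psi> A B)"
      using Suc by simp
    have "twist N (\<lambda>A B. complex_of_real (sg E j) * eproj E N \<psi> A B)
        = (\<lambda>A B. complex_of_real (sg E j) * twist N (eproj E N \<psi>) A B)"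
      using twist_linear[of N "complex_of_real (sg E j)" _ 0] by simp
    then show ?thesis
      unfolding eproj.simps twist_linear twist_commute[of j N] IH by (simp add: algebra_simps)
  qed
qed simp

lemma eproj_insert: "N \<le> j \<Longrightarrow> eproj (insert j E) N \<psi> = eproj E N \<psi>"
  by (induction N) (simp_all add: sg_def)

text \<open>The factors for the two signs of one index add up to the identity.\<close>

lemma sum_eproj: "(\<Sum>E\<in>Pow {..<N}. eproj E N \<psi> A B) = \<psi> A B"
proof (induction N)
  case (Suc N)
  have "(\<Sum>E\<in>Pow {..<Suc N}. eproj E (Suc N) \<psi> A B)
      = (\<Sum>E\<in>Pow {..<N}. eproj E (Suc N) \<psi> A B + eproj (insert N E) (Suc N) \<psi> A B)"
    by (simp add: sum_Pow_lessThan_Suc sum.distrib del: eproj.simps)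
  also have "\<dots> = (\<Sum>E\<in>Pow {..<N}. eproj E N \<psi> A B)"
    by (rule sum.cong[OF refl]) (auto simp: eproj_insert sg_def)
  finally show ?case using Suc by simp
qed simp

lemma eproj_support:
  assumes "eproj E N (\<lambda>A B. if A = A0 \<and> B = B0 then 1 else 0) A B \<noteq> 0"
  shows "sym_diff (set_decode A) (set_decode A0) \<subseteq> {..<N}"
  using assms
proof (induction N arbitrary: A B)
  case 0
  then show ?case by (auto split: if_splits)
next
  case (Suc N)
  let ?\<phi> = "eproj E N (\<lambda>A B. if A = A0 \<and> B = B0 then 1 else 0)"
  have "\<not> (?\<phi> A B = 0 \<and> ?\<phi> (flip N A) (flip N B) = 0)"
    using Suc.prems by (auto simp: twist_def)
  then consider "?\<phi> A B \<noteq> 0" | "?\<phi> (flip N A) (flip N B) \<noteq> 0" by blast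
  then show ?case
  proof cases
    case 1
    from Suc.IH[OF this] show ?thesis by auto
  next
    case 2
    from Suc.IH[OF this] have "sym_diff (sym_diff (set_decode A) {N}) (set_decode A0) \<subseteq> {..<N}" by simp
    then show ?thesis unfolding lessThan_Suc by blast
  qed
qed

text \<open>Every factor contributes 1/2, as its twisted term lands off the support. The value is
  the same for all \<open>E\<close>: under the trace all sign patterns are equally likely, which
  makes the signs independent.\<close>

lemma eproj_diag: "eproj E N (\<lambda>A B. if A = A0 \<and> B = B0 then 1 else 0) A0 B0 = 1 / 2 ^ N"
proof (induction N)
  case (Suc N)
  let ?\<phi> = "eproj E N (\<lambda>A B. if A = A0 \<and> B = B0 then 1 else 0)"
  have "?\<phi> (flip N A0) (flip N B0) = 0"
  proof (rule ccontr)
    assume "?\<phi> (flip N A0) (flip N B0) \<noteq> 0"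
    from eproj_support[OF this]
    have "sym_diff (sym_diff (set_decode A0) {N}) (set_decode A0) \<subseteq> {..<N}" by simp
    moreover have "N \<in> sym_diff (sym_diff (set_decode A0) {N}) (set_decode A0)" by blast
    ultimately show False by blast
  qed
  then show ?case using Suc by (simp add: twist_def)
qed simp

section \<open>The action of \<open>M\<close> tensor \<open>M\<close> on functions of two Fock
  indices\<close>

definition tens_app :: "nat \<Rightarrow> complex mat \<Rightarrow> (nat \<Rightarrow> nat \<Rightarrow> complex) \<Rightarrow> nat \<Rightarrow> nat \<Rightarrow> complex" where
  "tens_app N M \<psi> A B = (\<Sum>A'<2 ^ N. \<Sum>B'<2 ^ N. M $$ (A, A') * M $$ (B, B') * \<psi> A' B')"

lemma tens_app_cong:
  "(\<And>A B. A < 2 ^ N \<Longrightarrow> B < 2 ^ N \<Longrightarrow> \<psi> A B = \<phi> A B) \<Longrightarrow> tens_app N M \<psi> = tens_app N M \<phi>"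
  by (intro ext) (simp add: tens_app_def)

lemma tens_app_scale: "tens_app N M (\<lambda>A B. c * \<psi> A B) = (\<lambda>A B. c * tens_app N M \<psi> A B)"
  by (intro ext) (simp add: tens_app_def sum_distrib_left mult_ac)

lemma tens_app_one:
  assumes "A < 2 ^ N" "B < 2 ^ N"
  shows "tens_app N (1\<^sub>m (2 ^ N)) \<psi> A B = \<psi> A B"
proof -
  have "(\<Sum>B'<2 ^ N. 1\<^sub>m (2 ^ N) $$ (A, A') * 1\<^sub>m (2 ^ N) $$ (B, B') * \<psi> A' B')
      = (\<Sum>B'<2 ^ N. if B' = B then (if A' = A then \<psi> A B else 0) else 0)" if "A' < 2 ^ N" for A'
    using assms that by (intro sum.cong refl) auto
  then show ?thesis using assms by (simp add: tens_app_def)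
qed

lemma tens_app_fermion:
  assumes "j < N" "A < 2 ^ N" "B < 2 ^ N"
  shows "tens_app N (fermion N j) \<psi> A B = twist j \<psi> A B"
proof -
  have "(\<Sum>B'<2 ^ N. fermion N j $$ (A, A') * fermion N j $$ (B, B') * \<psi> A' B')
      = (\<Sum>B'<2 ^ N. if B' = flip j B then (if A' = flip j A then twist j \<psi> A B else 0) else 0)"
    if "A' < 2 ^ N" for A'
    using assms that by (intro sum.cong refl) (simp add: fermion_index twist_def)
  then show ?thesis using assms flip_less[of j N] by (simp add: tens_app_def)
qed

lemma sum_swap_pairs:
  "(\<Sum>a\<in>S. \<Sum>b\<in>S. \<Sum>c\<in>T. \<Sum>d\<in>T. f a b c d) = (\<Sum>c\<in>T. \<Sum>d\<in>T. \<Sum>a\<in>S. \<Sum>b\<in>S. f a b c d)"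
proof -
  have "(\<Sum>a\<in>S. \<Sum>b\<in>S. \<Sum>c\<in>T. \<Sum>d\<in>T. f a b c d) = (\<Sum>a\<in>S. \<Sum>c\<in>T. \<Sum>b\<in>S. \<Sum>d\<in>T. f a b c d)"
    by (rule sum.cong[OF refl], rule sum.swap)
  also have "\<dots> = (\<Sum>c\<in>T. \<Sum>a\<in>S. \<Sum>b\<in>S. \<Sum>d\<in>T. f a b c d)"
    by (rule sum.swap)
  also have "\<dots> = (\<Sum>c\<in>T. \<Sum>a\<in>S. \<Sum>d\<in>T. \<Sum>b\<in>S. f a b c d)"
    by (rule sum.cong[OF refl], rule sum.cong[OF refl], rule sum.swap)
  also have "\<dots> = (\<Sum>c\<in>T. \<Sum>d\<in>T. \<Sum>a\<in>S. \<Sum>b\<in>S. f a b c d)"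
    by (rule sum.cong[OF refl], rule sum.swap)
  finally show ?thesis .
qed

lemma tens_app_mult:
  assumes M: "M1 \<in> carrier_mat (2 ^ N) (2 ^ N)" "M2 \<in> carrier_mat (2 ^ N) (2 ^ N)"
    and AB: "A < 2 ^ N" "B < 2 ^ N"
  shows "tens_app N (M1 * M2) \<psi> A B = tens_app N M1 (tens_app N M2 \<psi>) A B"
proof -
  let ?I = "{..<2 ^ N} :: nat set"
  have ix: "(M1 * M2) $$ (A, A') = (\<Sum>C\<in>?I. M1 $$ (A, C) * M2 $$ (C, A'))"
    if "A < 2 ^ N" "A' \<in> ?I" for A A'
    using M that by (auto simp: scalar_prod_def lessThan_atLeast0)
  have "tens_app N (M1 * M2) \<psi> A B = (\<Sum>A'\<in>?I. \<Sum>B'\<in>?I. \<Sum>C\<in>?I. \<Sum>D\<in>?I.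
      (M1 $$ (A, C) * M2 $$ (C, A')) * (M1 $$ (B, D) * M2 $$ (D, B')) * \<psi> A' B')"
    unfolding tens_app_def using AB
    by (intro sum.cong refl)
      (simp only: ix[OF AB(1)] ix[OF AB(2)], simp only: sum_product, simp only: sum_distrib_right)
  also have "\<dots> = (\<Sum>C\<in>?I. \<Sum>D\<in>?I. \<Sum>A'\<in>?I. \<Sum>B'\<in>?I.
      (M1 $$ (A, C) * M2 $$ (C, A')) * (M1 $$ (B, D) * M2 $$ (D, B')) * \<psi> A' B')"
    by (rule sum_swap_pairs)
  also have "\<dots> = tens_app N M1 (tens_app N M2 \<psi>) A B"
    unfolding tens_app_def by (simp add: sum_distrib_left mult_ac)
  finally show ?thesis .
qed

text \<open>Every letter acts as a scalar on a joint eigenfunction, so the reversed order in the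
  adjoint does not matter. The adjoint is included for \<open>mat_adjoint X * X\<close>
  below.\<close>

lemma tens_app_fermion_word:
  assumes eig: "\<And>j. j < N \<Longrightarrow> twist j \<psi> = (\<lambda>A B. c j * \<psi> A B)"
    and "set js \<subseteq> {..<N}" "A < 2 ^ N" "B < 2 ^ N"
  shows "tens_app N (fermion_word N js) \<psi> A B = prod_list (map c js) * \<psi> A B
    \<and> tens_app N (mat_adjoint (fermion_word N js)) \<psi> A B = prod_list (map c js) * \<psi> A B"
  using assms(2-4)
proof (induction js arbitrary: A B)
  case Nil
  have "mat_adjoint (1\<^sub>m (2 ^ N) :: complex mat) = 1\<^sub>m (2 ^ N)"
    by (rule eq_matI) (auto simp: mat_adjoint_index)
  then show ?case
    using Nil by (simp_all add: fermion_word_Nil tens_app_one)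
next
  case (Cons j js)
  let ?W = "fermion_word N js"
  have j: "j < N" using Cons.prems by simp
  have aW: "mat_adjoint ?W \<in> carrier_mat (2 ^ N) (2 ^ N)" by simp
  have "tens_app N (fermion_word N (j # js)) \<psi> A B = tens_app N (fermion N j) (tens_app N ?W \<psi>) A B"
    unfolding fermion_word_Cons by (rule tens_app_mult) (use Cons in auto)
  also have "tens_app N (fermion N j) (tens_app N ?W \<psi>)
      = tens_app N (fermion N j) (\<lambda>A B. prod_list (map c js) * \<psi> A B)"
    by (rule tens_app_cong) (use Cons in auto)
  also have "\<dots> A B = prod_list (map c js) * twist j \<psi> A B"
    unfolding tens_app_scale using j Cons.prems by (simp add: tens_app_fermion)
  finally have 1: "tens_app N (fermion_word N (j # js)) \<psi> A B = prod_list (map c (j # js)) * \<psi> A B"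
    using eig[OF j] by simp
  have "tens_app N (mat_adjoint (fermion_word N (j # js))) \<psi> A B
      = tens_app N (mat_adjoint ?W) (tens_app N (fermion N j) \<psi>) A B"
    unfolding fermion_word_Cons mat_adjoint_mult[OF fermion_carrier fermion_word_carrier] mat_adjoint_fermion
    by (rule tens_app_mult) (use Cons in auto)
  also have "tens_app N (mat_adjoint ?W) (tens_app N (fermion N j) \<psi>)
      = tens_app N (mat_adjoint ?W) (\<lambda>A B. c j * \<psi> A B)"
    by (rule tens_app_cong) (use j eig[OF j] in \<open>simp add: tens_app_fermion\<close>)
  also have "\<dots> A B = c j * (prod_list (map c js) * \<psi> A B)"
    unfolding tens_app_scale using Cons by simp
  finally have "tens_app N (mat_adjoint (fermion_word N (j # js))) \<psi> A B = prod_list (map c (j # js)) * \<psi> A B"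
    by simp
  with 1 show ?case ..
qed

text \<open>The first argument becomes the block number and the second the index within the block,
  as in \<open>block_mat\<close>.\<close>

definition tens_vec :: "nat \<Rightarrow> (nat \<Rightarrow> nat \<Rightarrow> complex) \<Rightarrow> complex vec" where
  "tens_vec N \<psi> = vec (2 ^ N * 2 ^ N) (\<lambda>r. \<psi> (r div 2 ^ N) (r mod 2 ^ N))"

lemma tens_vec_carrier [simp]: "tens_vec N \<psi> \<in> carrier_vec (2 ^ N * 2 ^ N)"
  by (simp add: tens_vec_def)

lemma dim_tens_vec [simp]: "dim_vec (tens_vec N \<psi>) = 2 ^ N * 2 ^ N"
  by (simp add: tens_vec_def)

lemma tens_vec_index: "r < 2 ^ N * 2 ^ N \<Longrightarrow> tens_vec N \<psi> $ r = \<psi> (r div 2 ^ N) (r mod 2 ^ N)"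
  by (simp add: tens_vec_def)

lemma sum_div_mod:
  fixes f :: "nat \<Rightarrow> nat \<Rightarrow> 'a :: comm_monoid_add"
  assumes "L > 0"
  shows "(\<Sum>s<K * L. f (s div L) (s mod L)) = (\<Sum>A<K. \<Sum>B<L. f A B)"
proof -
  have "(\<Sum>s<K * L. f (s div L) (s mod L)) = (\<Sum>(A, B)\<in>{..<K} \<times> {..<L}. f A B)"
  proof (rule sum.reindex_bij_witness[where i = "\<lambda>(A, B). A * L + B" and j = "\<lambda>s. (s div L, s mod L)"])
    fix a assume "a \<in> {..<K} \<times> {..<L}"
    then obtain A B where a: "a = (A, B)" "A < K" "B < L" by auto
    then have "A * L + B < Suc A * L" by simp
    also have "\<dots> \<le> K * L" using a by (intro mult_right_mono) auto
    finally show "(case a of (A, B) \<Rightarrow> A * L + B) \<in> {..<K * L}" using a by simp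
  qed (use assms in \<open>auto simp: less_mult_imp_div_less\<close>)
  then show ?thesis by (simp add: sum.cartesian_product)
qed

section \<open>Spectrum and trace of the Rademacher operator\<close>

text \<open>\<open>\<alpha> 1 + \<beta> \<Sum>\<^sub>j \<omega>\<^sub>j \<otimes> \<omega>\<^sub>j + \<gamma> W \<otimes> W\<close>\<close>

definition rademacher_mat :: "nat \<Rightarrow> real \<Rightarrow> real \<Rightarrow> real \<Rightarrow> complex mat \<Rightarrow> complex mat" where
  "rademacher_mat N \<alpha> \<beta> \<gamma> W = mat (2 ^ N * 2 ^ N) (2 ^ N * 2 ^ N) (\<lambda>(r, s).
     complex_of_real \<alpha> * (if r = s then 1 else 0)
     + complex_of_real \<beta> * (\<Sum>j<N. fermion N j $$ (r div 2 ^ N, s div 2 ^ N) * fermion N j $$ (r mod 2 ^ N, s mod 2 ^ N))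
     + complex_of_real \<gamma> * (W $$ (r div 2 ^ N, s div 2 ^ N) * W $$ (r mod 2 ^ N, s mod 2 ^ N)))"

lemma rademacher_mat_carrier [simp]: "rademacher_mat N \<alpha> \<beta> \<gamma> W \<in> carrier_mat (2 ^ N * 2 ^ N) (2 ^ N * 2 ^ N)"
  by (simp add: rademacher_mat_def)

lemma mat_adjoint_rademacher_mat:
  assumes W: "W \<in> carrier_mat (2 ^ N) (2 ^ N)"
  shows "mat_adjoint (rademacher_mat N \<alpha> \<beta> \<gamma> W) = rademacher_mat N \<alpha> \<beta> \<gamma> (mat_adjoint W)"
proof (rule eq_matI)
  fix r s assume "r < dim_row (rademacher_mat N \<alpha> \<beta> \<gamma> (mat_adjoint W))"
    "s < dim_col (rademacher_mat N \<alpha> \<beta> \<gamma> (mat_adjoint W))"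
  then have rs: "r < 2 ^ N * 2 ^ N" "s < 2 ^ N * 2 ^ N" by (simp_all add: rademacher_mat_def)
  then have d: "r div 2 ^ N < 2 ^ N" "s div 2 ^ N < 2 ^ N" by (simp_all add: less_mult_imp_div_less)
  have f: "cnj (fermion N j $$ (B, A)) = fermion N j $$ (A, B)" if "A < 2 ^ N" "B < 2 ^ N" for j A B
    using that by (auto simp: fermion_index pos_flip_le)
  show "mat_adjoint (rademacher_mat N \<alpha> \<beta> \<gamma> W) $$ (r, s) = rademacher_mat N \<alpha> \<beta> \<gamma> (mat_adjoint W) $$ (r, s)"
    using rs d W by (simp add: mat_adjoint_index rademacher_mat_def f)
qed (simp_all add: rademacher_mat_def)

lemma rademacher_mat_mult_vec:
  assumes r: "r < 2 ^ N * 2 ^ N"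
  defines "A \<equiv> r div 2 ^ N" and "B \<equiv> r mod 2 ^ N"
  shows "(rademacher_mat N \<alpha> \<beta> \<gamma> W *\<^sub>v tens_vec N \<psi>) $ r
    = complex_of_real \<alpha> * \<psi> A B + complex_of_real \<beta> * (\<Sum>j<N. twist j \<psi> A B)
      + complex_of_real \<gamma> * tens_app N W \<psi> A B"
proof -
  let ?K = "2 ^ N :: nat"
  have AB: "A < ?K" "B < ?K" using r by (simp_all add: A_def B_def less_mult_imp_div_less)
  have tens: "(\<Sum>s<?K * ?K. (M $$ (A, s div ?K) * M $$ (B, s mod ?K)) * \<psi> (s div ?K) (s mod ?K)) = tens_app N M \<psi> A B" for M
    unfolding tens_app_def by (rule sum_div_mod) simp
  have "(rademacher_mat N \<alpha> \<beta> \<gamma> W *\<^sub>v tens_vec N \<psi>) $ r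
      = (\<Sum>s<?K * ?K. rademacher_mat N \<alpha> \<beta> \<gamma> W $$ (r, s) * \<psi> (s div ?K) (s mod ?K))"
    using r by (auto simp: scalar_prod_def lessThan_atLeast0 tens_vec_def rademacher_mat_def
        intro!: sum.cong)
  also have "\<dots> = (\<Sum>s<?K * ?K. (if s = r then complex_of_real \<alpha> * \<psi> A B else 0)
      + complex_of_real \<beta> * (\<Sum>j<N. (fermion N j $$ (A, s div ?K) * fermion N j $$ (B, s mod ?K)) * \<psi> (s div ?K) (s mod ?K))
      + complex_of_real \<gamma> * ((W $$ (A, s div ?K) * W $$ (B, s mod ?K)) * \<psi> (s div ?K) (s mod ?K)))"
    using r by (intro sum.cong refl)
      (auto simp: rademacher_mat_def A_def B_def algebra_simps sum_distrib_left sum_distrib_right)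
  also have "\<dots> = complex_of_real \<alpha> * \<psi> A B
      + complex_of_real \<beta> * (\<Sum>s<?K * ?K. \<Sum>j<N. (fermion N j $$ (A, s div ?K) * fermion N j $$ (B, s mod ?K)) * \<psi> (s div ?K) (s mod ?K))
      + complex_of_real \<gamma> * tens_app N W \<psi> A B"
    unfolding sum.distrib sum_distrib_left[symmetric] tens using r by simp
  also have "(\<Sum>s<?K * ?K. \<Sum>j<N. (fermion N j $$ (A, s div ?K) * fermion N j $$ (B, s mod ?K)) * \<psi> (s div ?K) (s mod ?K))
      = (\<Sum>j<N. twist j \<psi> A B)"
    by (subst sum.swap) (simp add: tens tens_app_fermion AB)
  finally show ?thesis .
qed

definition rademacher_val :: "nat \<Rightarrow> real \<Rightarrow> real \<Rightarrow> real \<Rightarrow> nat set \<Rightarrow> real" where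
  "rademacher_val N \<alpha> \<beta> \<gamma> E = \<alpha> + \<beta> * (\<Sum>j<N. sg E j) + \<gamma> * (\<Prod>j<N. sg E j)"

text \<open>Admitting both the word and its adjoint shows that the operator and its adjoint share
  these eigenvectors and their real eigenvalues.\<close>

lemma rademacher_mat_eigenvector:
  assumes W: "W = fermion_word N [0..<N] \<or> W = mat_adjoint (fermion_word N [0..<N])"
  shows "rademacher_mat N \<alpha> \<beta> \<gamma> W *\<^sub>v tens_vec N (eproj E N \<psi>)
     = complex_of_real (rademacher_val N \<alpha> \<beta> \<gamma> E) \<cdot>\<^sub>v tens_vec N (eproj E N \<psi>)"
proof (rule eq_vecI)
  fix r assume "r < dim_vec (complex_of_real (rademacher_val N \<alpha> \<beta> \<gamma> E) \<cdot>\<^sub>v tens_vec N (eproj E N \<psi>))"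
  then have r: "r < 2 ^ N * 2 ^ N" by (simp add: tens_vec_def)
  then have d: "r div 2 ^ N < 2 ^ N" by (simp add: less_mult_imp_div_less)
  have "tens_app N W (eproj E N \<psi>) (r div 2 ^ N) (r mod 2 ^ N)
      = prod_list (map (\<lambda>j. complex_of_real (sg E j)) [0..<N]) * eproj E N \<psi> (r div 2 ^ N) (r mod 2 ^ N)"
    using W tens_app_fermion_word[where \<psi> = "eproj E N \<psi>" and js = "[0..<N]" and B = "r mod 2 ^ N",
      OF twist_eproj _ d]
    by (auto simp: lessThan_atLeast0)
  also have "prod_list (map (\<lambda>j. complex_of_real (sg E j)) [0..<N]) = complex_of_real (\<Prod>j<N. sg E j)"
    by (simp add: prod.list_conv_set_nth lessThan_atLeast0)
  finally show "(rademacher_mat N \<alpha> \<beta> \<gamma> W *\<^sub>v tens_vec N (eproj E N \<psi>)) $ r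
     = (complex_of_real (rademacher_val N \<alpha> \<beta> \<gamma> E) \<cdot>\<^sub>v tens_vec N (eproj E N \<psi>)) $ r"
    using r unfolding rademacher_mat_mult_vec[OF r]
    by (simp add: tens_vec_index twist_eproj rademacher_val_def sum_distrib_left sum_distrib_right algebra_simps)
qed (simp add: rademacher_mat_def tens_vec_def)

text \<open>Each coordinate vector is split into joint eigenvectors, in which every sign pattern has
  weight \<open>1 / 2 ^ N\<close>.\<close>

lemma tr_Tr_hermitian_fun_rademacher:
  fixes f :: "real \<Rightarrow> real" and N :: nat and \<alpha> \<beta> \<gamma> :: real
  defines "X \<equiv> rademacher_mat N \<alpha> \<beta> \<gamma> (fermion_word N [0..<N])"
  shows "tr_Tr N (2 ^ N) (hermitian_fun f (mat_adjoint X * X))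
     = complex_of_real (\<Sum>E\<in>Pow {..<N}. f ((rademacher_val N \<alpha> \<beta> \<gamma> E)\<^sup>2))"
proof -
  let ?m = "2 ^ N * 2 ^ N :: nat"
  let ?v = "rademacher_val N \<alpha> \<beta> \<gamma>"
  have X: "X \<in> carrier_mat ?m ?m" by (simp add: X_def)
  have aX: "mat_adjoint X \<in> carrier_mat ?m ?m" using X by simp
  note H = adjoint_mult_self_hermitian[OF X]
  define F where "F = hermitian_fun f (mat_adjoint X * X)"
  have eig: "F *\<^sub>v tens_vec N (eproj E N \<psi>) = complex_of_real (f ((?v E)\<^sup>2)) \<cdot>\<^sub>v tens_vec N (eproj E N \<psi>)" for E \<psi>
    unfolding F_def
  proof (rule hermitian_fun_eigenvector[OF H])
    let ?u = "tens_vec N (eproj E N \<psi>)"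
    have "(mat_adjoint X * X) *\<^sub>v ?u = mat_adjoint X *\<^sub>v (complex_of_real (?v E) \<cdot>\<^sub>v ?u)"
      unfolding assoc_mult_mat_vec[OF aX X tens_vec_carrier]
      using rademacher_mat_eigenvector[of "fermion_word N [0..<N]" N \<alpha> \<beta> \<gamma> E \<psi>] by (simp add: X_def)
    also have "\<dots> = complex_of_real (?v E) \<cdot>\<^sub>v (mat_adjoint X *\<^sub>v ?u)"
      by (rule mult_mat_vec[OF aX tens_vec_carrier])
    also have "mat_adjoint X *\<^sub>v ?u = complex_of_real (?v E) \<cdot>\<^sub>v ?u"
      unfolding X_def mat_adjoint_rademacher_mat[OF fermion_word_carrier]
      by (rule rademacher_mat_eigenvector) simp
    finally show "(mat_adjoint X * X) *\<^sub>v ?u = complex_of_real ((?v E)\<^sup>2) \<cdot>\<^sub>v ?u"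
      by (simp add: smult_smult_assoc power2_eq_square)
  qed simp
  have F: "F \<in> carrier_mat ?m ?m"
  proof -
    obtain U d where dec: "spectral_decomp (mat_adjoint X * X) U d"
      using hermitian_spectral[OF H] by blast
    then have U: "U \<in> carrier_mat ?m ?m" using X by (simp add: spectral_decomp_def)
    then have "mat_adjoint U \<in> carrier_mat ?m ?m" by simp
    then show ?thesis unfolding F_def hermitian_fun_eq[OF dec] using X U
      by (simp add: mult_carrier_mat[of _ ?m ?m _ ?m])
  qed
  have diag: "F $$ (r, r) = complex_of_real (\<Sum>E\<in>Pow {..<N}. f ((?v E)\<^sup>2)) / 2 ^ N" if r: "r < ?m" for r
  proof -
    define \<delta> where "\<delta> = (\<lambda>A B. if A = r div 2 ^ N \<and> B = r mod 2 ^ N then 1 else 0 :: complex)"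
    have \<delta>: "\<delta> (s div 2 ^ N) (s mod 2 ^ N) = (if s = r then 1 else 0)" for s
      unfolding \<delta>_def by (metis div_mult_mod_eq)
    have "F $$ (r, r) = (\<Sum>s<?m. F $$ (r, s) * \<delta> (s div 2 ^ N) (s mod 2 ^ N))"
      using r by (simp add: \<delta> if_distrib[of "\<lambda>z. _ * z"] cong: if_cong)
    also have "\<dots> = (\<Sum>s<?m. \<Sum>E\<in>Pow {..<N}. F $$ (r, s) * tens_vec N (eproj E N \<delta>) $ s)"
      by (intro sum.cong refl) (simp add: tens_vec_index sum_distrib_left[symmetric] sum_eproj)
    also have "\<dots> = (\<Sum>E\<in>Pow {..<N}. (F *\<^sub>v tens_vec N (eproj E N \<delta>)) $ r)"
      using r F by (subst sum.swap) (auto simp: scalar_prod_def lessThan_atLeast0 tens_vec_def intro!: sum.cong)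
    also have "\<dots> = (\<Sum>E\<in>Pow {..<N}. complex_of_real (f ((?v E)\<^sup>2)) / 2 ^ N)"
    proof (rule sum.cong[OF refl])
      fix E
      have "eproj E N \<delta> (r div 2 ^ N) (r mod 2 ^ N) = 1 / 2 ^ N"
        unfolding \<delta>_def by (rule eproj_diag)
      then show "(F *\<^sub>v tens_vec N (eproj E N \<delta>)) $ r = complex_of_real (f ((?v E)\<^sup>2)) / 2 ^ N"
        unfolding eig using r by (simp add: tens_vec_def)
    qed
    finally show ?thesis by (simp add: sum_divide_distrib)
  qed
  \<comment> \<open>One diagonal entry is taken from each of the \<open>2 ^ N\<close> blocks, which
    cancels the weight.\<close>
  show ?thesis unfolding tr_Tr_index F_def[symmetric] by (simp add: diag)
qed

text \<open>The first tensor factor is absorbed into the matrix algebra of size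
  \<open>2 ^ (2 * n)\<close>: its matrix entries become the coefficients in \<open>F_comb\<close>.
  The second factor stays in \<open>F_space n\<close>.\<close>

definition rademacher_elt :: "nat \<Rightarrow> real \<Rightarrow> real \<Rightarrow> real \<Rightarrow> nat \<Rightarrow> nat \<Rightarrow> complex mat" where
  "rademacher_elt n \<alpha> \<beta> \<gamma> i i' = F_comb n (complex_of_real \<alpha> * (if i = i' then 1 else 0))
     (\<lambda>j. complex_of_real \<beta> * fermion (2 * n) j $$ (i, i')) (complex_of_real \<gamma> * fermion_prod n $$ (i, i'))"

lemma rademacher_elt_mem: "rademacher_elt n \<alpha> \<beta> \<gamma> \<in> mats_over k (F_space n)"
  by (auto simp: mats_over_def F_space_def rademacher_elt_def)

lemma amplify_tau_rademacher_elt: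
  "n \<ge> 1 \<Longrightarrow> amplify (tau n) (rademacher_elt n \<alpha> \<beta> \<gamma>) = rademacher_elt n \<alpha> \<beta> (- \<gamma>)"
  by (intro ext) (simp add: amplify_def rademacher_elt_def tau_F_comb)

lemma block_mat_rademacher_elt:
  "block_mat (2 * n) (2 ^ (2 * n)) (rademacher_elt n \<alpha> \<beta> \<gamma>)
     = rademacher_mat (2 * n) \<alpha> \<beta> \<gamma> (fermion_word (2 * n) [0..<2 * n])"
proof (rule eq_matI)
  let ?K = "2 ^ (2 * n) :: nat"
  fix r s assume "r < dim_row (rademacher_mat (2 * n) \<alpha> \<beta> \<gamma> (fermion_word (2 * n) [0..<2 * n]))"
    "s < dim_col (rademacher_mat (2 * n) \<alpha> \<beta> \<gamma> (fermion_word (2 * n) [0..<2 * n]))"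
  then have rs: "r < ?K * ?K" "s < ?K * ?K" by (simp_all add: rademacher_mat_def)
  have rseq: "r = s \<longleftrightarrow> r div ?K = s div ?K \<and> r mod ?K = s mod ?K" by (metis div_mult_mod_eq)
  show "block_mat (2 * n) ?K (rademacher_elt n \<alpha> \<beta> \<gamma>) $$ (r, s)
     = rademacher_mat (2 * n) \<alpha> \<beta> \<gamma> (fermion_word (2 * n) [0..<2 * n]) $$ (r, s)"
    using rs unfolding rseq fermion_prod_eq_word[symmetric] rademacher_mat_def block_mat_def
    by (simp add: rademacher_elt_def F_comb_index rseq sum_distrib_left mult.assoc)
qed (simp_all add: rademacher_mat_def block_mat_def)

lemma Lp_norm_rademacher_elt:
  "Lp_norm p (2 * n) (2 ^ (2 * n)) (rademacher_elt n \<alpha> \<beta> \<gamma>)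
     = (\<Sum>E\<in>Pow {..<2 * n}. \<bar>rademacher_val (2 * n) \<alpha> \<beta> \<gamma> E\<bar> powr p) powr (1 / p)"
proof -
  have "(x\<^sup>2) powr (p / 2) = \<bar>x\<bar> powr p" for x :: real
  proof -
    have "x\<^sup>2 = \<bar>x\<bar> powr 2" by simp
    then show ?thesis by (simp only: powr_powr) simp
  qed
  then show ?thesis
    unfolding Lp_norm_adjoint_mult_self block_mat_rademacher_elt tr_Tr_hermitian_fun_rademacher by simp
qed

section \<open>Comparison of moments by scaling\<close>

lemma rademacher_val_card:
  assumes "E \<subseteq> {..<N}"
  shows "rademacher_val N \<alpha> \<beta> \<gamma> E = \<alpha> + \<beta> * (real N - 2 * real (card E)) + \<gamma> * (- 1) ^ card E"
proof -
  have E: "{..<N} \<inter> {j. j \<in> E} = E" using assms by auto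
  have "sg E j = 1 - 2 * (if j \<in> E then 1 else 0)" for j by (simp add: sg_def)
  then have "(\<Sum>j<N. sg E j) = real N - 2 * (\<Sum>j<N. if j \<in> E then 1 else 0)"
    by (simp add: sum_subtractf sum_distrib_left)
  moreover have "(\<Sum>j<N. if j \<in> E then 1 else 0) = real (card E)"
    using E by (simp add: sum.If_cases)
  moreover have "(\<Prod>j<N. sg E j) = (- 1) ^ card E"
    using E by (simp add: sg_def prod.If_cases)
  ultimately show ?thesis by (simp add: rademacher_val_def)
qed

text \<open>The sum over all signs of \<open>\<bar>a + \<Sum>\<^sub>j \<epsilon>\<^sub>j / 2 + g \<Prod>\<^sub>j \<epsilon>\<^sub>j\<bar>\<^sup>p\<close>, where \<open>E\<close> is the set of the \<open>j\<close> with
  \<open>\<epsilon>\<^sub>j = -1\<close>.\<close>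

definition rademacher_moment :: "real \<Rightarrow> nat \<Rightarrow> real \<Rightarrow> real \<Rightarrow> real" where
  "rademacher_moment p n a g = (\<Sum>E\<in>Pow {..<2 * n}. \<bar>a + real n - real (card E) + g * (- 1) ^ card E\<bar> powr p)"

lemma rademacher_moment_nonneg: "rademacher_moment p n a g \<ge> 0"
  by (simp add: rademacher_moment_def sum_nonneg)

text \<open>Half the sum of the signs runs through consecutive integers, which will turn moments
  into differences with unit step. The factor \<open>t\<close> serves to normalise.\<close>

lemma Lp_norm_scaled_rademacher_elt:
  assumes t: "t \<ge> 0"
  shows "Lp_norm p (2 * n) (2 ^ (2 * n)) (rademacher_elt n (t * a) (t / 2) (t * g))
     = (t powr p * rademacher_moment p n a g) powr (1 / p)"
proof -
  have "\<bar>rademacher_val (2 * n) (t * a) (t / 2) (t * g) E\<bar> powr p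
      = t powr p * \<bar>a + real n - real (card E) + g * (- 1) ^ card E\<bar> powr p" if "E \<in> Pow {..<2 * n}" for E
  proof -
    have "rademacher_val (2 * n) (t * a) (t / 2) (t * g) E = t * (a + real n - real (card E) + g * (- 1) ^ card E)"
      using that by (simp add: rademacher_val_card algebra_simps)
    then show ?thesis using t by (simp add: abs_mult powr_mult)
  qed
  then show ?thesis
    unfolding Lp_norm_rademacher_elt rademacher_moment_def by (simp add: sum_distrib_left)
qed

text \<open>The contraction condition only compares norms with 1; homogeneity turns it into a
  comparison of moments.\<close>

lemma scaled_le_imp_le:
  fixes S S' p :: real
  assumes p: "p > 0" and S: "S \<ge> 0"
    and imp: "\<And>t. t \<ge> 0 \<Longrightarrow> t powr p * S \<le> 1 \<Longrightarrow> t powr p * S' \<le> 1"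
  shows "S' \<le> S"
proof (rule ccontr)
  assume "\<not> S' \<le> S"
  then have less: "S < S'" by simp
  \<comment> \<open>\<open>t powr p\<close> is the reciprocal of the midpoint of \<open>S\<close>
    and \<open>S'\<close>, so 1 lies strictly between the scaled values.\<close>
  define t where "t = (2 / (S + S')) powr (1 / p)"
  have tp: "t powr p = 2 / (S + S')" using less S p by (simp add: t_def powr_powr)
  have "t powr p * S \<le> 1" unfolding tp using less S by (simp add: field_simps)
  then have "t powr p * S' \<le> 1" by (intro imp) (simp_all add: t_def)
  then show False unfolding tp using less S by (simp add: field_simps)
qed

lemma rademacher_moment_neg_le:
  assumes n: "n \<ge> 1" and p: "1 \<le> p"
    and cb: "cb_norm p (2 * n) (F_space n) (tau n) \<le> 1"
  shows "rademacher_moment p n a (- g) \<le> rademacher_moment p n a g"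
proof (rule scaled_le_imp_le)
  fix t :: real assume t: "t \<ge> 0" and le: "t powr p * rademacher_moment p n a g \<le> 1"
  have le1: "y powr (1 / p) \<le> 1 \<longleftrightarrow> y \<le> 1" if "y \<ge> 0" for y :: real
  proof -
    have "0 < 1 / p" using p by simp
    then show ?thesis
      using that powr_mono2[of "1 / p" y 1] powr_less_mono2[of "1 / p" 1 y] by (cases "y \<le> 1") (auto simp: not_le)
  qed
  let ?x = "rademacher_elt n (t * a) (t / 2) (t * g)"
  have nn: "t powr p * rademacher_moment p n a h \<ge> 0" for h
    by (simp add: rademacher_moment_nonneg)
  have "Lp_norm p (2 * n) (2 ^ (2 * n)) ?x \<le> 1"
    unfolding Lp_norm_scaled_rademacher_elt[OF t] le1[OF nn] by (rule le)
  then have "Lp_norm p (2 * n) (2 ^ (2 * n)) (amplify (tau n) ?x) \<le> 1"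
    using cb rademacher_elt_mem unfolding cb_norm_le_1_iff by simp
  then have "Lp_norm p (2 * n) (2 ^ (2 * n)) (rademacher_elt n (t * a) (t / 2) (t * (- g))) \<le> 1"
    by (simp add: amplify_tau_rademacher_elt[OF n])
  then show "t powr p * rademacher_moment p n a (- g) \<le> 1"
    unfolding Lp_norm_scaled_rademacher_elt[OF t] le1[OF nn] .
qed (use p rademacher_moment_nonneg in auto)

lemma cb_norm_tau_le_1_imp_even:
  assumes n: "n \<ge> 1" and p: "1 \<le> p"
    and cb: "cb_norm p (2 * n) (F_space n) (tau n) \<le> 1"
  shows "\<exists>m::int. even m \<and> p = of_int m \<and> m \<le> int (2 * n)"
proof (rule bdiff_funpow_abs_powr_diff[OF p])
  fix m :: int
  \<comment> \<open>This cancels \<open>real n\<close> in \<open>rademacher_moment\<close> and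
    leaves \<open>m - card E\<close>, as in \<open>bdiff_funpow\<close>.\<close>
  let ?a = "real_of_int m - real n"
  \<comment> \<open>The inequality for both signs of \<open>g\<close> gives equality.\<close>
  have eq: "rademacher_moment p n ?a (- 1) = rademacher_moment p n ?a 1"
    using rademacher_moment_neg_le[OF assms, of ?a 1] rademacher_moment_neg_le[OF assms, of ?a "- 1"] by simp
  \<comment> \<open>For odd \<open>k\<close> the sign of the product exchanges the two powers, which
    supplies the alternating sign of the difference.\<close>
  have "(- 1) ^ k * (\<bar>u + 1\<bar> powr p - \<bar>u - 1\<bar> powr p)
      = \<bar>u + 1 * (- 1) ^ k\<bar> powr p - \<bar>u + (- 1) * (- 1) ^ k\<bar> powr p" for u :: real and k :: nat
    by (cases "even k") simp_all
  then have "(bdiff ^^ (2 * n)) (\<lambda>m. \<bar>real_of_int m + 1\<bar> powr p - \<bar>real_of_int m - 1\<bar> powr p) m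
      = rademacher_moment p n ?a 1 - rademacher_moment p n ?a (- 1)"
    unfolding bdiff_funpow rademacher_moment_def sum_subtractf[symmetric] by simp
  then show "(bdiff ^^ (2 * n)) (\<lambda>m. \<bar>real_of_int m + 1\<bar> powr p - \<bar>real_of_int m - 1\<bar> powr p) m = 0"
    using eq by simp
qed

theorem theorem7p7:
  fixes n :: nat and p :: real
  assumes "n \<ge> 1" and "1 \<le> p"
  shows "(cb_norm p (2 * n) (F_space n) (tau n) \<le> 1
            \<longleftrightarrow> complete_isometry p (2 * n) (F_space n) (tau n))
       \<and> (cb_norm p (2 * n) (F_space n) (tau n) \<le> 1
            \<longleftrightarrow> (\<exists>m::int. even m \<and> p = of_int m) \<and> real (2 * n) \<ge> p)"
proof -
  have even: "(\<exists>m::int. even m \<and> p = of_int m) \<and> real (2 * n) \<ge> p"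
    if "cb_norm p (2 * n) (F_space n) (tau n) \<le> 1"
    using cb_norm_tau_le_1_imp_even[OF assms that] by auto
  have iso: "complete_isometry p (2 * n) (F_space n) (tau n)"
    if "(\<exists>m::int. even m \<and> p = of_int m) \<and> real (2 * n) \<ge> p"
  proof -
    from that obtain l :: int where l: "p = of_int (2 * l)" by (auto elim: evenE)
    with assms that have "l \<ge> 1" "l \<le> int n" by auto
    then show ?thesis
      using complete_isometry_tau_even[OF assms(1), of "nat l"] l by simp
  qed
  show ?thesis using even iso complete_isometry_imp_cb_norm_le_1 by blast
qed

end
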